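(* Let $p\equiv 1\pmod 9$ be a prime number which can be represented by the form $7x^2+3xy+9y^2$, i.e. $p=7x^2+3xy+9y^2$ for some integers $x,y$. Then $\mathbb{Q}(\sqrt[3]{p})$ is non-monogenic.
   Context: A number field $K$ with ring of integers $\mathcal{O}_K$ is called monogenic if there exists $\alpha\in\mathcal{O}_K$ such that $\mathcal{O}_K=\mathbb{Z}[\alpha]$; otherwise it is non-monogenic. *)

theory Defs
  imports
    "HOL-Algebra.Algebraic_Closure_Type"
    "HOL-Algebra.Generated_Rings"
    "HOL-Algebra.Generated_Fields"
    "HOL-Number_Theory.Cong"
    "HOL-Computational_Algebra.Computational_Algebra"
begin

text \<open>
  Number fields are treated as subfields, given by their underlying sets, of an ambient
  field of characteristic 0 (such as the real or the complex numbers).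
\<close>

text \<open>
  The field \<open>\<rat>(S)\<close>: since the characteristic is 0, the prime field \<open>\<rat>\<close> is contained in
  every subfield, so \<open>\<rat>(S)\<close> is just the subfield generated by \<open>S\<close>.
\<close>
definition rat_adjoin :: "'a::field_char_0 set \<Rightarrow> 'a set" where
  "rat_adjoin S = generate_field ring_of_type_algebra S"

text \<open>Likewise \<open>\<int>[S]\<close> is the (unital) subring generated by \<open>S\<close>.\<close>
definition int_adjoin :: "'a::field_char_0 set \<Rightarrow> 'a set" where
  "int_adjoin S = generate_ring ring_of_type_algebra S"

definition ring_of_integers :: "'a::field_char_0 set \<Rightarrow> 'a set" where
  "ring_of_integers K = {x \<in> K. algebraic_int x}"

definition monogenic :: "'a::field_char_0 set \<Rightarrow> bool" where
  "monogenic K \<longleftrightarrow> (\<exists>\<alpha> \<in> ring_of_integers K. ring_of_integers K = int_adjoin {\<alpha>})"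

end

theory Submission
  imports Defs "HOL-Number_Theory.Number_Theory"
begin

text \<open>
  Let \<open>\<theta>\<close> be the real cube root of \<open>p\<close>. The proof has an algebraic half, which turns
  monogenicity into the solvability of a cubic congruence, and an arithmetic half, which
  shows that the quadratic form forbids that congruence.

  \<^emph>\<open>Index form.\<close> Since \<open>p \<equiv> 1 (mod 9)\<close>, the number \<open>(1 + \<theta> + \<theta>\<^sup>2) / 3\<close> is an algebraic
  integer, and every irrational algebraic integer \<open>a + b\<theta> + c\<theta>\<^sup>2\<close> of the field has \<open>b = B / 3\<close>
  and \<open>c = C / 3\<close> with integers \<open>B \<equiv> C (mod 3)\<close>; this is read off from the characteristic
  polynomial, whose coefficients are integers by Gauss's lemma. If \<open>\<alpha> = a + b\<theta> + c\<theta>\<^sup>2\<close>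
  generates the ring of integers, then \<open>\<theta>\<close> and \<open>(1 + \<theta> + \<theta>\<^sup>2) / 3\<close> are integral combinations
  of \<open>1, \<alpha>, \<alpha>\<^sup>2\<close>. Comparing \<open>2 \<times> 2\<close> determinants of coordinates shows that \<open>B\<^sup>3 - p C\<^sup>3\<close>
  divides \<open>9\<close>, while \<open>B \<equiv> C (mod 3)\<close> makes it a multiple of \<open>9\<close>. So it is \<open>\<plusminus> 9\<close>, and \<open>9\<close> is
  a cube modulo \<open>p\<close>; equivalently, \<open>3\<close> is (\<open>nine_is_cube_if_monogenic\<close>).

  \<^emph>\<open>Cubic residuacity of 3.\<close> Let \<open>\<chi>\<close> be a cubic character modulo \<open>p\<close>, with Jacobi sum \<open>J\<close>,
  the sum of \<open>\<chi>(t) \<chi>(1 - t)\<close>, so that \<open>|J|\<^sup>2 = p\<close>. Picking out the nonzero cubes by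
  \<open>1 + \<chi> + \<chi>\<^sup>2\<close> gives \<open>J = 2 + 3 (A + B\<omega> + C\<omega>\<^sup>2)\<close>, where \<open>A, B, C\<close> count the cubes \<open>c \<noteq> 1\<close>
  for which \<open>\<chi>(1 - c)\<close> is \<open>1, \<omega>, \<omega>\<^sup>2\<close>. On the other hand the product of the \<open>1 - c\<close> is
  the number \<open>(p - 1) / 3\<close> of cubes, being the value at \<open>1\<close> of \<open>(x\<^sup>n - 1) / (x - 1)\<close> for
  \<open>n = (p - 1) / 3\<close>, and \<open>3 n \<equiv> - 1\<close>. So if \<open>3\<close> is a cube then \<open>B + 2 C\<close>, and hence \<open>B - C\<close>,
  is divisible by \<open>3\<close>, and \<open>|J|\<^sup>2 = p\<close> becomes \<open>4 p = L\<^sup>2 + 243 M\<^sup>2\<close>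
  (\<open>represents_4p_if_3_cube\<close>).

  \<^emph>\<open>Conclusion.\<close> The last equation represents \<open>p\<close> by the principal class of binary forms of
  discriminant \<open>- 243\<close>, whereas \<open>7 x\<^sup>2 + 3 x y + 9 y\<^sup>2\<close> belongs to another class of the same
  discriminant and represents \<open>28 p\<close> as \<open>u\<^sup>2 + 243 y\<^sup>2\<close>. Composing the two representations and
  dividing by \<open>p\<^sup>2\<close> would represent \<open>112\<close> as \<open>s\<^sup>2 + 243 k\<^sup>2\<close>, which is impossible because \<open>112\<close>
  is not a square (\<open>forms_disjoint\<close>).
\<close>

section \<open>Polynomials and sums over residues modulo a prime\<close>

text \<open>
  Lagrange's bound on the number of roots over the field with \<open>p\<close> elements, phrased with
  integer polynomials: splitting off the factor \<open>x - c\<close> by synthetic division lowers the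
  degree and costs one root.
\<close>
lemma prime_dvd_int_poly_if_many_roots:
  fixes Q :: "int poly" and p :: int
  assumes "Factorial_Ring.prime p" "finite S" "degree Q < card S"
    and "\<And>c. c \<in> S \<Longrightarrow> p dvd poly Q c"
    and "\<And>c d. c \<in> S \<Longrightarrow> d \<in> S \<Longrightarrow> p dvd c - d \<Longrightarrow> c = d"
  shows "p dvd poly Q x"
  using assms(2-)
proof (induction "degree Q" arbitrary: Q S)
  case 0
  from "0.hyps" obtain k where Q: "Q = [:k:]" by (metis degree_eq_zeroE)
  from "0.prems"(2) obtain c where "c \<in> S" by fastforce
  with "0.prems"(3) Q show ?case by force
next
  case (Suc n)
  from Suc.prems(2) obtain c where c: "c \<in> S" by fastforce
  define R where "R = synthetic_div Q c"
  have Q: "poly Q y = (y - c) * poly R y + poly Q c" for y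
    by (subst synthetic_div_correct'[of c Q, symmetric]) (simp add: R_def algebra_simps)
  have "p dvd poly R x"
  proof (rule Suc.hyps(1)[of R "S - {c}"])
    show "n = degree R" using Suc.hyps(2) by (simp add: R_def degree_synthetic_div)
    then show "degree R < card (S - {c})"
      using Suc.hyps(2) Suc.prems(1,2) c by simp
    show "p dvd poly R d" if "d \<in> S - {c}" for d
    proof -
      have "p dvd (d - c) * poly R d"
        using Suc.prems(3)[of d] Suc.prems(3)[OF c] that Q[of d]
        by (simp add: dvd_add_left_iff)
      moreover have "\<not> p dvd d - c" using Suc.prems(4)[of d c] that c by auto
      ultimately show ?thesis using assms(1) prime_dvd_multD by blast
    qed
  qed (use Suc.prems in auto)
  with Suc.prems(3)[OF c] show ?case by (subst Q) simp
qed

lemma fermat_int: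
  fixes x :: int
  assumes "\<not> int p dvd x" "Factorial_Ring.prime p"
  shows "[x ^ (p - 1) = 1] (mod int p)"
proof -
  have "p > 0" using assms(2) prime_gt_0_nat by blast
  then obtain a where a: "int a = x mod int p"
    by (metis of_nat_0_less_iff pos_mod_sign zero_le_imp_eq_int)
  then have x: "[x = int a] (mod int p)" by (simp add: Cong.cong_def)
  then have "\<not> p dvd a" using assms(1) by (simp add: cong_dvd_iff)
  then have "[int (a ^ (p - 1)) = int 1] (mod int p)"
    using fermat_theorem[OF assms(2)] cong_int_iff by blast
  then have "[int a ^ (p - 1) = 1] (mod int p)" by simp
  with cong_pow[OF x, of "p - 1"] show ?thesis by (rule cong_trans)
qed

lemma bij_betw_affine_mod:
  assumes "p > 0" "Rings.coprime a (int p)"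
  shows "bij_betw (\<lambda>x. (a * x + b) mod int p) {0..<int p} {0..<int p}"
proof -
  have "inj_on (\<lambda>x. (a * x + b) mod int p) {0..<int p}"
  proof (rule inj_onI)
    fix x y assume xy: "x \<in> {0..<int p}" "y \<in> {0..<int p}"
      and "(a * x + b) mod int p = (a * y + b) mod int p"
    then have "[a * x + b = a * y + b] (mod int p)" by (simp add: Cong.cong_def)
    then have "[a * x = a * y] (mod int p)" by (simp add: cong_add_rcancel)
    then have "[x = y] (mod int p)" using assms(2) by (simp add: cong_mult_lcancel)
    then show "x = y" using xy by (simp add: Cong.cong_def)
  qed
  moreover have "(\<lambda>x. (a * x + b) mod int p) ` {0..<int p} \<subseteq> {0..<int p}"
    using assms(1) by auto
  ultimately show ?thesis
    by (simp add: bij_betw_def endo_inj_surj)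
qed

text \<open>
  The substitutions \<open>x \<mapsto> a x + b\<close> take the place of the additive and multiplicative
  translations of the field with \<open>p\<close> elements.
\<close>
lemma sum_residues_affine:
  fixes F :: "int \<Rightarrow> 'a::comm_monoid_add"
  assumes "p > 0" "Rings.coprime a (int p)"
    and F: "\<And>x y. [x = y] (mod int p) \<Longrightarrow> F x = F y"
  shows "(\<Sum>x\<in>{0..<int p}. F (a * x + b)) = (\<Sum>x\<in>{0..<int p}. F x)"
proof -
  have "(\<Sum>x\<in>{0..<int p}. F x) = (\<Sum>x\<in>{0..<int p}. F ((a * x + b) mod int p))"
    using sum.reindex_bij_betw[OF bij_betw_affine_mod[OF assms(1,2)], of F b] by simp
  also have "\<dots> = (\<Sum>x\<in>{0..<int p}. F (a * x + b))"
    by (intro sum.cong refl F) (simp add: Cong.cong_def)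
  finally show ?thesis by simp
qed

section \<open>Cubic characters\<close>

definition \<omega> :: complex where "\<omega> = Complex (- 1 / 2) (sqrt 3 / 2)"

lemma omega_square: "\<omega>\<^sup>2 = - 1 - \<omega>"
  by (simp add: \<omega>_def complex_eq_iff power2_eq_square)

lemma omega_cube: "\<omega> ^ 3 = 1"
  by (simp add: \<omega>_def complex_eq_iff power3_eq_cube)

lemma omega_neq_one: "\<omega> \<noteq> 1" "\<omega>\<^sup>2 \<noteq> 1"
  by (simp_all add: \<omega>_def complex_eq_iff power2_eq_square)

lemma cube_root_of_unity_cases:
  assumes "z ^ 3 = (1::complex)"
  shows "z = 1 \<or> z = \<omega> \<or> z = \<omega>\<^sup>2"
proof -
  have "(z - 1) * (z - \<omega>) * (z - \<omega>\<^sup>2) =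
      z ^ 3 - (1 + \<omega> + \<omega>\<^sup>2) * z\<^sup>2 + (\<omega> + \<omega>\<^sup>2 + \<omega> ^ 3) * z - \<omega> ^ 3"
    by (simp add: algebra_simps power2_eq_square power3_eq_cube)
  also have "\<dots> = 0" by (simp add: omega_cube omega_square assms)
  finally show ?thesis by auto
qed

lemma omega_power_mod_3: "\<omega> ^ n = \<omega> ^ (n mod 3)"
proof -
  have "\<omega> ^ n = (\<omega> ^ 3) ^ (n div 3) * \<omega> ^ (n mod 3)"
    by (simp flip: power_mult power_add)
  then show ?thesis by (simp add: omega_cube)
qed

lemma omega_power_eq_one_iff: "\<omega> ^ n = 1 \<longleftrightarrow> 3 dvd n"
proof -
  have "n mod 3 = 0 \<or> n mod 3 = 1 \<or> n mod 3 = 2" by linarith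
  then show ?thesis
    using omega_neq_one by (subst omega_power_mod_3) (auto simp: dvd_eq_mod_eq_0)
qed

locale cubic_character =
  fixes p :: nat and \<chi> :: "int \<Rightarrow> complex"
  assumes prime_p: "Factorial_Ring.prime p"
    and chi_eq_0_iff: "\<chi> x = 0 \<longleftrightarrow> int p dvd x"
    and chi_mult: "\<chi> (x * y) = \<chi> x * \<chi> y"
    and chi_cong: "[x = y] (mod int p) \<Longrightarrow> \<chi> x = \<chi> y"
    and chi_power_3: "\<not> int p dvd x \<Longrightarrow> \<chi> x ^ 3 = 1"
    and chi_eq_1D: "\<chi> x = 1 \<Longrightarrow> \<exists>y. [x = y ^ 3] (mod int p)"
    and chi_nontrivial: "\<exists>g. \<not> int p dvd g \<and> \<chi> g \<noteq> 1"

text \<open>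
  With \<open>g\<close> a primitive root, \<open>\<chi>(g\<^sup>k) = \<omega>\<^sup>k\<close> depends only on the residue, because \<open>3\<close> divides
  the order \<open>p - 1\<close> of \<open>g\<close>.
\<close>
theorem cubic_character_exists:
  assumes "Factorial_Ring.prime p" "[p = 1] (mod 3)"
  shows "\<exists>\<chi>. cubic_character p \<chi>"
proof -
  have p1: "p > 1" using assms(1) prime_gt_1_nat by blast
  have tot: "totient p = p - 1" using assms(1) totient_prime by blast
  have d3: "3 dvd p - 1" using assms(2) p1 by (metis cong_to_1_nat)
  obtain g where g: "residue_primroot p g"
    using prime_primitive_root_exists[OF p1 assms(1)] by blast
  then have ordg: "ord p g = p - 1" and cop: "Rings.coprime p g"
    by (auto simp: residue_primroot_def tot)
  have ndvd: "\<not> int p dvd int g ^ k" for k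
    using cop p1 assms(1)
    by (metis coprime_absorb_left int_dvd_int_iff not_prime_unit of_nat_power prime_dvd_power)
  have ex: "\<exists>k. [x = int g ^ k] (mod int p)" if "\<not> int p dvd x" for x
  proof -
    define r where "r = nat (x mod int p)"
    have r: "int r = x mod int p" using p1 by (simp add: r_def)
    then have "r \<noteq> 0" using that by (auto simp: dvd_eq_mod_eq_0)
    moreover have "r < p" using r p1 by (metis of_nat_less_iff pos_mod_bound of_nat_0_less_iff gr_implies_not0 neq0_conv)
    ultimately have "r \<in> totatives p"
      by (simp add: totatives_prime[OF assms(1)])
    then obtain k where "r = g ^ k mod p"
      using bij_betw_imp_surj_on[OF residue_primroot_is_generator[OF p1 g]] by blast
    then have "x mod int p = int g ^ k mod int p" using r by (simp add: zmod_int)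
    then show ?thesis by (auto simp: Cong.cong_def)
  qed
  define \<chi> where "\<chi> x = (if int p dvd x then 0 else \<omega> ^ (SOME k. [x = int g ^ k] (mod int p)))" for x
  have chi: "\<chi> x = \<omega> ^ k" if "[x = int g ^ k] (mod int p)" for x k
  proof -
    define l where "l = (SOME k. [x = int g ^ k] (mod int p))"
    have l: "[x = int g ^ l] (mod int p)" unfolding l_def using that by (rule someI)
    have nx: "\<not> int p dvd x" using that ndvd[of k] by (simp add: cong_dvd_iff)
    have "[int g ^ l = int g ^ k] (mod int p)" using l that by (metis cong_sym cong_trans)
    then have "[g ^ l = g ^ k] (mod p)" by (metis cong_int_iff of_nat_power)
    then have "[l = k] (mod (p - 1))"
      using order_divides_expdiff[OF cop, of l k] by (simp add: ordg)
    then have "[l = k] (mod 3)" using d3 by (rule cong_dvd_modulus_nat)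
    then have "\<omega> ^ l = \<omega> ^ k" by (metis omega_power_mod_3 Cong.cong_def)
    with nx show ?thesis by (simp add: \<chi>_def l_def)
  qed
  have "cubic_character p \<chi>"
  proof
    show "Factorial_Ring.prime p" by fact
    show z: "\<chi> x = 0 \<longleftrightarrow> int p dvd x" for x
    proof -
      have "\<omega> \<noteq> 0" using omega_cube by force
      then show ?thesis by (simp add: \<chi>_def)
    qed
    show "\<chi> (x * y) = \<chi> x * \<chi> y" for x y
    proof (cases "int p dvd x \<or> int p dvd y")
      case True then show ?thesis by (auto simp: \<chi>_def)
    next
      case False
      then obtain k l where kl: "[x = int g ^ k] (mod int p)" "[y = int g ^ l] (mod int p)"
        using ex by blast
      then have "[x * y = int g ^ (k + l)] (mod int p)"
        by (simp add: power_add cong_mult)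
      then have "\<chi> (x * y) = \<omega> ^ (k + l)" by (rule chi)
      with kl show ?thesis by (simp add: chi power_add)
    qed
    show "\<chi> x = \<chi> y" if "[x = y] (mod int p)" for x y
    proof (cases "int p dvd y")
      case True then show ?thesis using that by (simp add: \<chi>_def cong_dvd_iff)
    next
      case False
      then obtain k where "[y = int g ^ k] (mod int p)" using ex by blast
      then show ?thesis using that chi by (metis cong_trans)
    qed
    show "\<chi> x ^ 3 = 1" if "\<not> int p dvd x" for x
    proof -
      obtain k where "[x = int g ^ k] (mod int p)" using ex \<open>\<not> int p dvd x\<close> by blast
      then have "\<chi> x ^ 3 = (\<omega> ^ 3) ^ k" by (simp add: chi flip: power_mult) (simp add: mult.commute)
      then show ?thesis by (simp add: omega_cube)
    qed
    show "\<exists>y. [x = y ^ 3] (mod int p)" if "\<chi> x = 1" for x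
    proof -
      have "\<not> int p dvd x" using z[of x] that by auto
      then obtain k where k: "[x = int g ^ k] (mod int p)" using ex by blast
      then have "3 dvd k" using that chi omega_power_eq_one_iff by auto
      then obtain j where "k = 3 * j" by blast
      with k have "[x = (int g ^ j) ^ 3] (mod int p)" by (simp add: mult.commute flip: power_mult)
      then show ?thesis by blast
    qed
    have "\<chi> (int g) = \<omega>" using chi[of "int g" 1] by simp
    then show "\<exists>g. \<not> int p dvd g \<and> \<chi> g \<noteq> 1" using ndvd[of 1] omega_neq_one by (metis power_one_right)
  qed
  then show ?thesis by blast
qed

context cubic_character
begin

lemma p_gt_1: "p > 1"
  using prime_p prime_gt_1_nat by blast

lemma sum_affine:
  fixes F :: "int \<Rightarrow> 'a::comm_monoid_add"
  assumes "\<not> int p dvd a" "\<And>x y. [x = y] (mod int p) \<Longrightarrow> F x = F y"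
  shows "(\<Sum>x\<in>{0..<int p}. F (a * x + b)) = (\<Sum>x\<in>{0..<int p}. F x)"
proof (rule sum_residues_affine)
  have "Factorial_Ring.prime (int p)" using prime_p by simp
  then show "Rings.coprime a (int p)"
    using assms(1) prime_imp_coprime Rings.coprime_commute by blast
qed (use p_gt_1 assms(2) in auto)

lemma chi_1 [simp]: "\<chi> 1 = 1"
proof -
  have "\<chi> 1 * \<chi> 1 = \<chi> 1" using chi_mult[of 1 1] by simp
  moreover have "\<chi> 1 \<noteq> 0" using chi_eq_0_iff p_gt_1 by auto
  ultimately show ?thesis by simp
qed

lemma chi_0 [simp]: "\<chi> 0 = 0"
  by (simp add: chi_eq_0_iff)

lemma chi_uminus [simp]: "\<chi> (- x) = \<chi> x"
proof -
  have 2: "\<chi> (- 1) * \<chi> (- 1) = 1" using chi_mult[of "- 1" "- 1"] by simp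
  have "\<chi> (- 1) ^ 3 = 1" using p_gt_1 by (intro chi_power_3) auto
  with 2 have "\<chi> (- 1) = 1" by (simp add: power3_eq_cube)
  then show ?thesis using chi_mult[of "- 1" x] by simp
qed

lemma chi_cube_eq_1: "\<not> int p dvd x \<Longrightarrow> \<chi> (x ^ 3) = 1"
  using chi_power_3[of x] by (simp add: power3_eq_cube chi_mult)

lemma chi_prod: "\<chi> (\<Prod>x\<in>A. f x) = (\<Prod>x\<in>A. \<chi> (f x))"
  by (induction A rule: infinite_finite_induct) (simp_all add: chi_mult)

lemma cnj_chi: "cnj (\<chi> x) = (\<chi> x)\<^sup>2"
proof (cases "int p dvd x")
  case True then show ?thesis using chi_eq_0_iff[of x] by simp
next
  case False
  have "cnj \<omega> = \<omega>\<^sup>2" "cnj (\<omega>\<^sup>2) = (\<omega>\<^sup>2)\<^sup>2"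
    by (simp_all add: \<omega>_def complex_eq_iff power2_eq_square)
  then show ?thesis
    using cube_root_of_unity_cases[OF chi_power_3[OF False]] by auto
qed

lemma chi_mult_cnj: "\<chi> x * cnj (\<chi> x) = (if int p dvd x then 0 else 1)"
  using chi_power_3[of x] chi_eq_0_iff[of x] by (auto simp: cnj_chi power2_eq_square power3_eq_cube mult.assoc)

text \<open>
  Multiplying by a residue \<open>g\<close> with \<open>\<chi>(g) \<noteq> 1\<close> permutes the summands but scales the sum.
\<close>
lemma sum_chi: "(\<Sum>x\<in>{0..<int p}. \<chi> x) = 0"
proof -
  obtain g where g: "\<not> int p dvd g" "\<chi> g \<noteq> 1" using chi_nontrivial by blast
  have "(\<Sum>x\<in>{0..<int p}. \<chi> (g * x + 0)) = (\<Sum>x\<in>{0..<int p}. \<chi> x)"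
    using g(1) by (intro sum_affine chi_cong)
  then have "\<chi> g * (\<Sum>x\<in>{0..<int p}. \<chi> x) = (\<Sum>x\<in>{0..<int p}. \<chi> x)"
    by (simp add: chi_mult sum_distrib_left)
  with g(2) show ?thesis by simp
qed

lemma sum_chi_shift: "(\<Sum>x\<in>{0..<int p}. \<chi> (x + b)) = 0"
  using sum_affine[of 1 \<chi> b] chi_cong p_gt_1 sum_chi by simp

lemma sum_cnj_chi: "(\<Sum>x\<in>{0..<int p}. cnj (\<chi> x)) = 0"
  using sum_chi by (metis cnj_sum complex_cnj_zero)

lemma residues_insert_0: "{0..<int p} = insert 0 {1..<int p}" "0 \<notin> {1..<int p}"
  using p_gt_1 by auto

lemma not_dvd_residue: "x \<in> {1..<int p} \<Longrightarrow> \<not> int p dvd x"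
  using zdvd_imp_le by fastforce

lemma of_nat_p_minus_1: "of_nat (nat (int p - 1)) = (of_nat p - 1 :: complex)"
  using p_gt_1 by (simp add: nat_diff_distrib of_nat_diff)

lemma sum_chi_mult_cnj: "(\<Sum>x\<in>{0..<int p}. \<chi> x * cnj (\<chi> x)) = of_nat p - 1"
proof -
  have "(\<Sum>x\<in>{1..<int p}. \<chi> x * cnj (\<chi> x)) = (\<Sum>x\<in>{1..<int p}. 1)"
    by (intro sum.cong refl) (use not_dvd_residue chi_mult_cnj in auto)
  also have "\<dots> = of_nat p - 1" by (simp add: of_nat_p_minus_1)
  finally show ?thesis by (simp add: residues_insert_0)
qed

section \<open>The Jacobi sum\<close>

lemma correlation_cong:
  assumes "[u = v] (mod int p)"
  shows "\<chi> (u + a) * cnj (\<chi> u) = \<chi> (v + a) * cnj (\<chi> v)"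
proof -
  have "\<chi> (u + a) = \<chi> (v + a)" using assms by (intro chi_cong cong_add cong_refl)
  then show ?thesis using chi_cong[OF assms] by simp
qed

text \<open>
  Scaling shows that the sum depends only on whether \<open>p\<close> divides \<open>v\<close>. Its value for \<open>v = 0\<close>
  is \<open>p - 1\<close>, and the sum of all the values factors as \<open>|\<Sum>\<chi>|\<^sup>2 = 0\<close>, which
  determines the other one.
\<close>
lemma correlation:
  "(\<Sum>u\<in>{0..<int p}. \<chi> (u + v) * cnj (\<chi> u)) = (if int p dvd v then of_nat p else 0) - 1"
proof -
  define G where "G v = (\<Sum>u\<in>{0..<int p}. \<chi> (u + v) * cnj (\<chi> u))" for v
  have G_cong: "G v = of_nat p - 1" if "int p dvd v" for v
  proof -
    have "\<chi> (u + v) = \<chi> u" for u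
      using that by (intro chi_cong) (simp add: cong_iff_dvd_diff)
    then show ?thesis by (simp add: G_def sum_chi_mult_cnj)
  qed
  have G_1: "G v = G 1" if v: "\<not> int p dvd v" for v
  proof -
    have "G v = (\<Sum>u\<in>{0..<int p}. \<chi> ((v * u + 0) + v) * cnj (\<chi> (v * u + 0)))"
      unfolding G_def by (rule sum_affine[symmetric]) (use v correlation_cong in auto)
    also have "\<dots> = (\<Sum>u\<in>{0..<int p}. (\<chi> v * cnj (\<chi> v)) * (\<chi> (u + 1) * cnj (\<chi> u)))"
    proof (rule sum.cong)
      fix u
      have "(v * u + 0) + v = v * (u + 1)" by (simp add: algebra_simps)
      then show "\<chi> ((v * u + 0) + v) * cnj (\<chi> (v * u + 0))
          = (\<chi> v * cnj (\<chi> v)) * (\<chi> (u + 1) * cnj (\<chi> u))"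
        by (simp only: chi_mult add_0_right) simp
    qed simp
    also have "\<dots> = G 1" using v by (simp add: chi_mult_cnj G_def)
    finally show ?thesis .
  qed
  have "(\<Sum>v\<in>{0..<int p}. G v) = (\<Sum>u\<in>{0..<int p}. cnj (\<chi> u) * (\<Sum>v\<in>{0..<int p}. \<chi> (v + u)))"
    unfolding G_def by (subst sum.swap) (simp add: sum_distrib_left algebra_simps)
  also have "\<dots> = 0" by (simp add: sum_chi_shift)
  finally have "G 0 + (\<Sum>v\<in>{1..<int p}. G v) = 0" by (simp add: residues_insert_0)
  moreover have "(\<Sum>v\<in>{1..<int p}. G v) = (\<Sum>v\<in>{1..<int p}. G 1)"
    by (intro sum.cong refl G_1 not_dvd_residue)
  moreover have "(\<Sum>v\<in>{1..<int p}. G 1) = (of_nat p - 1) * G 1"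
    by (simp add: of_nat_p_minus_1)
  ultimately have "(of_nat p - 1) * (1 + G 1) = 0"
    using G_cong[of 0] by (simp add: distrib_left of_nat_p_minus_1)
  moreover have "of_nat p - (1::complex) \<noteq> 0" using p_gt_1 by auto
  ultimately have "G 1 = - 1" by (metis add_eq_0_iff2 mult_eq_0_iff add.commute)
  then show ?thesis using G_cong[of v] G_1[of v] by (auto simp: G_def)
qed

definition jacobi_sum :: complex where
  "jacobi_sum = (\<Sum>t\<in>{0..<int p}. \<chi> t * \<chi> (1 - t))"

lemma convolution:
  "(\<Sum>a\<in>{0..<int p}. \<chi> a * \<chi> (u - a)) = (\<chi> u)\<^sup>2 * jacobi_sum"
proof (cases "int p dvd u")
  case True
  have "\<chi> (u - a) = \<chi> (- a)" for a
    using True by (intro chi_cong) (simp add: cong_iff_dvd_diff)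
  then have "(\<Sum>a\<in>{0..<int p}. \<chi> a * \<chi> (u - a)) = (\<Sum>a\<in>{0..<int p}. cnj (\<chi> a))"
    by (simp add: cnj_chi power2_eq_square)
  then show ?thesis using True chi_eq_0_iff[of u] sum_cnj_chi by simp
next
  case False
  have "(\<Sum>a\<in>{0..<int p}. \<chi> a * \<chi> (u - a))
      = (\<Sum>a\<in>{0..<int p}. \<chi> (u * a + 0) * \<chi> (u - (u * a + 0)))"
  proof (rule sum_affine[symmetric, OF False])
    fix x y :: int assume xy: "[x = y] (mod int p)"
    then have "[u - x = u - y] (mod int p)" by (intro cong_diff cong_refl)
    with xy show "\<chi> x * \<chi> (u - x) = \<chi> y * \<chi> (u - y)" by (simp add: chi_cong)
  qed
  also have "\<dots> = (\<Sum>a\<in>{0..<int p}. (\<chi> u)\<^sup>2 * (\<chi> a * \<chi> (1 - a)))"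
  proof (rule sum.cong)
    fix a
    have "u - u * a = u * (1 - a)" by (simp add: algebra_simps)
    then show "\<chi> (u * a + 0) * \<chi> (u - (u * a + 0)) = (\<chi> u)\<^sup>2 * (\<chi> a * \<chi> (1 - a))"
      by (simp add: chi_mult power2_eq_square)
  qed simp
  finally show ?thesis by (simp add: jacobi_sum_def sum_distrib_left)
qed

text \<open>
  Parseval's argument without Gauss sums: the convolution \<open>f = \<chi> * \<chi>\<close> is \<open>J \<chi>\<^sup>2\<close>, so the
  sum of \<open>|f(u)|\<^sup>2\<close> is \<open>(p - 1) |J|\<^sup>2\<close>; expanding the same sum and applying
  the correlation formula to the variable \<open>u\<close> gives \<open>p (p - 1)\<close>.
\<close>
lemma jacobi_sum_norm: "jacobi_sum * cnj jacobi_sum = of_nat p"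
proof -
  let ?R = "{0..<int p}"
  define f where "f u = (\<Sum>a\<in>?R. \<chi> a * \<chi> (u - a))" for u
  have "f u * cnj (f u) = \<chi> u * cnj (\<chi> u) * (jacobi_sum * cnj jacobi_sum)" for u
  proof -
    have "f u * cnj (f u) = (\<chi> u * cnj (\<chi> u))\<^sup>2 * (jacobi_sum * cnj jacobi_sum)"
      by (simp add: f_def convolution power2_eq_square algebra_simps)
    then show ?thesis by (simp add: chi_mult_cnj)
  qed
  then have 1: "(\<Sum>u\<in>?R. f u * cnj (f u)) = (of_nat p - 1) * (jacobi_sum * cnj jacobi_sum)"
    by (simp add: sum_chi_mult_cnj flip: sum_distrib_right)
  \<comment> \<open>Translating \<open>u\<close> by \<open>c\<close> turns the sum over \<open>u\<close> into a correlation with offset \<open>c - a\<close>.\<close>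
  have shift: "(\<Sum>u\<in>?R. \<chi> (u - a) * cnj (\<chi> (u - c))) = (if a = c then of_nat p else 0) - 1"
    if ac: "a \<in> ?R" "c \<in> ?R" for a c
  proof -
    have "(\<Sum>u\<in>?R. \<chi> (u - a) * cnj (\<chi> (u - c)))
        = (\<Sum>u\<in>?R. \<chi> ((1 * u + - c) + (c - a)) * cnj (\<chi> (1 * u + - c)))"
      by (simp add: algebra_simps)
    also have "\<dots> = (\<Sum>u\<in>?R. \<chi> (u + (c - a)) * cnj (\<chi> u))"
      by (rule sum_affine) (use p_gt_1 correlation_cong in auto)
    also have "\<dots> = (if int p dvd c - a then of_nat p else 0) - 1" by (rule correlation)
    also have "int p dvd c - a \<longleftrightarrow> a = c"
      using ac by (metis atLeastLessThan_iff cong_iff_dvd_diff cong_less_imp_eq_int cong_refl)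
    finally show ?thesis .
  qed
  have "(\<Sum>u\<in>?R. f u * cnj (f u))
      = (\<Sum>u\<in>?R. \<Sum>a\<in>?R. \<Sum>c\<in>?R. (\<chi> a * cnj (\<chi> c)) * (\<chi> (u - a) * cnj (\<chi> (u - c))))"
    by (simp add: f_def sum_product mult_ac)
  also have "\<dots> = (\<Sum>a\<in>?R. \<Sum>c\<in>?R. \<Sum>u\<in>?R. (\<chi> a * cnj (\<chi> c)) * (\<chi> (u - a) * cnj (\<chi> (u - c))))"
    by (subst sum.swap) (intro sum.cong refl sum.swap)
  also have "\<dots> = (\<Sum>a\<in>?R. \<Sum>c\<in>?R. (\<chi> a * cnj (\<chi> c)) * ((if a = c then of_nat p else 0) - 1))"
    by (intro sum.cong refl) (simp add: shift flip: sum_distrib_left)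
  also have "\<dots> = (\<Sum>a\<in>?R. (\<Sum>c\<in>?R. if a = c then of_nat p * (\<chi> a * cnj (\<chi> c)) else 0)
                  - (\<Sum>c\<in>?R. \<chi> a * cnj (\<chi> c)))"
    unfolding sum_subtractf[symmetric] by (intro sum.cong refl) (auto simp: algebra_simps)
  also have "\<dots> = (\<Sum>a\<in>?R. of_nat p * (\<chi> a * cnj (\<chi> a)) - \<chi> a * (\<Sum>c\<in>?R. cnj (\<chi> c)))"
    by (intro sum.cong refl) (simp flip: sum_distrib_left)
  also have "\<dots> = of_nat p * (of_nat p - 1)"
    by (simp add: sum_cnj_chi sum_chi_mult_cnj flip: sum_distrib_left)
  finally have "(of_nat p - 1) * (jacobi_sum * cnj jacobi_sum) = (of_nat p - 1) * of_nat p"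
    using 1 by simp
  moreover have "of_nat p - (1::complex) \<noteq> 0" using p_gt_1 by auto
  ultimately show ?thesis by simp
qed

end

section \<open>The cubic character of 3\<close>

text \<open>
  The point is that the same multiplicities \<open>A, B, C\<close> of the values \<open>1, \<omega>, \<omega>\<^sup>2\<close> govern both
  the sum and the product.
\<close>
lemma sum_prod_cube_roots_of_unity:
  fixes f :: "'a \<Rightarrow> complex"
  assumes "finite S" "\<And>c. c \<in> S \<Longrightarrow> f c ^ 3 = 1"
  shows "\<exists>A B C :: nat. (\<Sum>c\<in>S. f c) = of_nat A + of_nat B * \<omega> + of_nat C * \<omega>\<^sup>2
           \<and> (\<Prod>c\<in>S. f c) = \<omega> ^ (B + 2 * C)"
  using assms
proof (induction S rule: finite_induct)
  case empty
  show ?case by (intro exI[of _ 0]) simp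
next
  case (insert c S)
  obtain A B C :: nat where ABC: "(\<Sum>c\<in>S. f c) = of_nat A + of_nat B * \<omega> + of_nat C * \<omega>\<^sup>2"
      "(\<Prod>c\<in>S. f c) = \<omega> ^ (B + 2 * C)"
    using insert.IH insert.prems by auto
  have "f c ^ 3 = 1" using insert.prems by blast
  then consider "f c = 1" | "f c = \<omega>" | "f c = \<omega>\<^sup>2" using cube_root_of_unity_cases by blast
  then show ?case
  proof cases
    case 1
    with ABC insert.hyps show ?thesis
      by (intro exI[of _ "Suc A"] exI[of _ B] exI[of _ C]) simp
  next
    case 2
    with ABC insert.hyps show ?thesis
      by (intro exI[of _ A] exI[of _ "Suc B"] exI[of _ C]) (simp add: algebra_simps)
  next
    case 3
    with ABC insert.hyps show ?thesis
      by (intro exI[of _ A] exI[of _ B] exI[of _ "Suc C"])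
        (simp add: algebra_simps power2_eq_square)
  qed
qed

lemma norm_of_eisenstein_integer:
  fixes a b :: int
  assumes "(of_int a + of_int b * \<omega>) * cnj (of_int a + of_int b * \<omega>) = of_int n"
  shows "4 * n = (2 * a - b)\<^sup>2 + 3 * b\<^sup>2"
proof -
  have "Re ((of_int a + of_int b * \<omega>) * cnj (of_int a + of_int b * \<omega>))
      = (real_of_int a + real_of_int b * Re \<omega>)\<^sup>2 + (real_of_int b * Im \<omega>)\<^sup>2"
    by (simp add: power2_eq_square)
  also have "\<dots> = (real_of_int a - real_of_int b / 2)\<^sup>2 + 3 / 4 * (real_of_int b)\<^sup>2"
    by (simp add: \<omega>_def power2_eq_square)
  finally have "real_of_int n = (real_of_int a - real_of_int b / 2)\<^sup>2 + 3 / 4 * (real_of_int b)\<^sup>2"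
    unfolding assms by simp
  then have "4 * real_of_int n = (2 * real_of_int a - real_of_int b)\<^sup>2 + 3 * (real_of_int b)\<^sup>2"
    by (simp add: power2_eq_square algebra_simps)
  then have "real_of_int (4 * n) = real_of_int ((2 * a - b)\<^sup>2 + 3 * b\<^sup>2)" by simp
  then show ?thesis by (simp only: of_int_eq_iff)
qed

context cubic_character
begin

definition cubes :: "int set" where "cubes = {c \<in> {1..<int p}. \<chi> c = 1}"

lemma cubes_indicator:
  assumes "t \<in> {0..<int p}"
  shows "(if t = 0 then 0 else 1) + \<chi> t + cnj (\<chi> t) = (if t \<in> cubes then 3 else 0)"
proof (cases "t = 0")
  case False
  with assms have t: "t \<in> {1..<int p}" by auto
  then have "\<chi> t = 1 \<or> \<chi> t = \<omega> \<or> \<chi> t = \<omega>\<^sup>2"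
    using chi_power_3 not_dvd_residue cube_root_of_unity_cases by blast
  then have "1 + \<chi> t + (\<chi> t)\<^sup>2 = (if \<chi> t = 1 then 3 else 0)"
  proof (elim disjE)
    assume "\<chi> t = \<omega>\<^sup>2"
    moreover have "1 + \<omega>\<^sup>2 + (\<omega>\<^sup>2)\<^sup>2 = 1 + \<omega>\<^sup>2 + \<omega> * \<omega> ^ 3"
      by (simp add: power2_eq_square power3_eq_cube)
    ultimately show ?thesis using omega_neq_one by (simp add: omega_cube omega_square)
  qed (use omega_neq_one in \<open>simp_all add: omega_square\<close>)
  with t False show ?thesis by (simp add: cnj_chi cubes_def)
qed (simp add: cubes_def)

lemma cubes_subset: "cubes \<subseteq> {0..<int p}"
  by (auto simp: cubes_def)

lemma finite_cubes: "finite cubes"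
  using cubes_subset finite_atLeastLessThan_int by (rule finite_subset)

lemma sum_over_cubes:
  "3 * (\<Sum>c\<in>cubes. F c)
     = (\<Sum>t\<in>{1..<int p}. F t) + (\<Sum>t\<in>{0..<int p}. \<chi> t * F t) + (\<Sum>t\<in>{0..<int p}. cnj (\<chi> t) * F t)"
proof -
  have "3 * (\<Sum>c\<in>cubes. F c) = (\<Sum>c\<in>cubes. 3 * F c)" by (simp add: sum_distrib_left)
  also have "\<dots> = (\<Sum>t\<in>{0..<int p}. (if t \<in> cubes then 3 else 0) * F t)"
    by (rule sum.mono_neutral_cong_left) (use cubes_subset in auto)
  also have "\<dots> = (\<Sum>t\<in>{0..<int p}. (if t = 0 then 0 else 1) * F t + \<chi> t * F t + cnj (\<chi> t) * F t)"
    by (intro sum.cong refl) (simp add: cubes_indicator[symmetric] distrib_right)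
  also have "\<dots> = (\<Sum>t\<in>{0..<int p}. (if t = 0 then 0 else 1) * F t)
      + (\<Sum>t\<in>{0..<int p}. \<chi> t * F t) + (\<Sum>t\<in>{0..<int p}. cnj (\<chi> t) * F t)"
    by (simp add: sum.distrib)
  also have "(\<Sum>t\<in>{0..<int p}. (if t = 0 then 0 else 1) * F t) = (\<Sum>t\<in>{1..<int p}. F t)"
    by (simp add: residues_insert_0)
  finally show ?thesis .
qed

lemma card_cubes: "3 * card cubes = p - 1"
proof -
  have "of_nat (3 * card cubes) = (of_nat (p - 1) :: complex)"
    using sum_over_cubes[of "\<lambda>_. 1"] p_gt_1
    by (simp add: sum_chi sum_cnj_chi of_nat_diff nat_diff_distrib)
  then show ?thesis by (simp only: of_nat_eq_iff)
qed

text \<open>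
  Summing \<open>\<chi>(1 - t)\<close> against each of the three terms of the indicator \<open>1 + \<chi> + \<chi>\<^sup>2\<close> of the
  cubes gives \<open>- 1\<close>, the Jacobi sum, and a correlation equal to \<open>- 1\<close>.
\<close>
lemma jacobi_sum_eq: "jacobi_sum = 2 + 3 * (\<Sum>c\<in>cubes. \<chi> (1 - c))"
proof -
  have reflect: "\<chi> (1 - t) = \<chi> (t + (- 1))" for t
    using chi_uminus[of "1 - t"] by (simp add: algebra_simps)
  have "(\<Sum>t\<in>{0..<int p}. \<chi> (1 - t)) = 0"
    using sum_chi_shift[of "- 1"] by (simp only: reflect)
  then have "(\<Sum>t\<in>{1..<int p}. \<chi> (1 - t)) = - 1"
    by (simp add: residues_insert_0 add_eq_0_iff)
  moreover have "(\<Sum>t\<in>{0..<int p}. cnj (\<chi> t) * \<chi> (1 - t)) = - 1"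
    using correlation[of "- 1"] p_gt_1 by (simp only: reflect mult.commute) simp
  ultimately show ?thesis
    using sum_over_cubes[of "\<lambda>t. \<chi> (1 - t)"] by (simp add: jacobi_sum_def)
qed

lemma one_in_cubes: "1 \<in> cubes"
  using p_gt_1 by (simp add: cubes_def)

text \<open>
  With \<open>n\<close> the number of nonzero cubes, \<open>1 + x + \<dots> + x\<^bsup>n-1\<^esup>\<close> and the product of the
  \<open>x - c\<close> over the cubes \<open>c \<noteq> 1\<close> are monic of degree \<open>n - 1\<close> and vanish at the same \<open>n - 1\<close>
  residues, so they agree modulo \<open>p\<close>, in particular at \<open>x = 1\<close>.
\<close>
lemma prod_one_minus_cubes:
  "[(\<Prod>c\<in>cubes - {1}. 1 - c) = int (card cubes)] (mod int p)"
proof -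
  define n where "n = card cubes"
  define S where "S = cubes - {1}"
  have n0: "n > 0" using one_in_cubes finite_cubes by (auto simp: n_def card_gt_0_iff)
  have fS: "finite S" and cS: "card S = n - 1"
    using finite_cubes one_in_cubes by (simp_all add: S_def n_def)
  define P where "P = (\<Sum>i<n. monom (1::int) i)"
  define Q where "Q = P - (\<Prod>c\<in>S. [:- c, 1:])"
  have P: "poly P x = (\<Sum>i<n. x ^ i)" for x
    by (simp add: P_def poly_sum poly_monom)
  have Q: "poly Q x = (\<Sum>i<n. x ^ i) - (\<Prod>c\<in>S. x - c)" for x
    by (simp add: Q_def P poly_prod)
  have prime: "Factorial_Ring.prime (int p)" using prime_p by simp
  have "int p dvd poly Q 1"
  proof (cases "n = 1")
    case True
    then have "S = {}" using cS fS by simp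
    then show ?thesis using True by (simp add: Q)
  next
    case False
    \<comment> \<open>The leading terms cancel, so \<open>Q\<close> has too small a degree for its \<open>n - 1\<close> roots.\<close>
    have "degree P \<le> n - 1" unfolding P_def
      by (rule degree_sum_le) (auto intro: order.trans[OF degree_monom_le])
    moreover have degR: "degree (\<Prod>c\<in>S. [:- c, 1:]) = n - 1"
      using degree_prod_sum_eq[of S "\<lambda>c. [:- c, 1:]"] cS by simp
    ultimately have "degree Q \<le> n - 1" unfolding Q_def by (intro degree_diff_le) auto
    moreover have "Polynomial.coeff Q (n - 1) = 0"
    proof -
      have "Polynomial.coeff (\<Prod>c\<in>S. [:- c, 1:]) (n - 1) = 1"
        using lead_coeff_prod[of "\<lambda>c. [:- c, 1:]" S] degR by simp
      moreover have "Polynomial.coeff P (n - 1) = 1"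
        using n0 by (simp add: P_def coeff_sum)
      ultimately show ?thesis by (simp add: Q_def)
    qed
    ultimately have "Q = 0 \<or> degree Q < n - 1" by (rule eq_zero_or_degree_less)
    then have "degree Q < card S" using cS n0 False by auto
    then show ?thesis
    proof (rule prime_dvd_int_poly_if_many_roots[OF prime fS])
      fix c assume c: "c \<in> S"
      then have cc: "c \<in> {1..<int p}" "\<chi> c = 1" "c \<noteq> 1" by (auto simp: S_def cubes_def)
      obtain y where y: "[c = y ^ 3] (mod int p)" using chi_eq_1D cc by blast
      have ny: "\<not> int p dvd y"
      proof
        assume "int p dvd y"
        then have "int p dvd y ^ 3" by (simp add: power3_eq_cube)
        then have "int p dvd c" using y by (simp add: cong_dvd_iff)
        then show False using cc not_dvd_residue by blast
      qed
      have "[c ^ n = (y ^ 3) ^ n] (mod int p)" using y by (rule cong_pow)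
      also have "(y ^ 3) ^ n = y ^ (p - 1)" using card_cubes by (simp add: n_def flip: power_mult)
      also have "[y ^ (p - 1) = 1] (mod int p)"
        using ny prime_p by (rule fermat_int)
      finally have "int p dvd c ^ n - 1" by (simp add: cong_iff_dvd_diff)
      also have "c ^ n - 1 = (c - 1) * (\<Sum>i<n. c ^ i)" by (rule power_diff_1_eq)
      finally have "int p dvd (c - 1) * (\<Sum>i<n. c ^ i)" .
      moreover have "\<not> int p dvd c - 1" using cc by (intro not_dvd_residue) auto
      ultimately have "int p dvd (\<Sum>i<n. c ^ i)" using prime prime_dvd_multD by blast
      moreover have "(\<Prod>d\<in>S. c - d) = 0" using c fS by auto
      ultimately show "int p dvd poly Q c" by (simp add: Q)
    next
      fix c d assume "c \<in> S" "d \<in> S" "int p dvd c - d"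
      then have "0 \<le> c" "c < int p" "0 \<le> d" "d < int p" "[c = d] (mod int p)"
        by (simp_all add: S_def cubes_def cong_iff_dvd_diff)
      then show "c = d" by (rule cong_less_imp_eq_int)
    qed
  qed
  then have "int p dvd int n - (\<Prod>c\<in>S. 1 - c)" by (simp add: Q)
  then have "[int n = (\<Prod>c\<in>S. 1 - c)] (mod int p)" by (simp add: cong_iff_dvd_diff)
  then show ?thesis unfolding n_def S_def by (rule cong_sym)
qed

text \<open>
  The general relation is \<open>4 p = L\<^sup>2 + 27 (B - C)\<^sup>2\<close>, with \<open>B, C\<close> the numbers of cubes
  \<open>c \<noteq> 1\<close> for which \<open>\<chi>(1 - c)\<close> is \<open>\<omega>\<close> or \<open>\<omega>\<^sup>2\<close>. The hypothesis enters through
  \<open>\<omega>\<^bsup>B+2C\<^esup> = \<chi>((p - 1) / 3)\<close>, the inverse of \<open>\<chi>(3)\<close>.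
\<close>
theorem represents_4p_if_3_cube:
  assumes "\<chi> 3 = 1"
  shows "\<exists>L M :: int. 4 * int p = L\<^sup>2 + 243 * M\<^sup>2"
proof -
  define S where "S = cubes - {1}"
  have "finite S" by (simp add: S_def finite_cubes)
  moreover have "\<chi> (1 - c) ^ 3 = 1" if "c \<in> S" for c
  proof -
    have "\<not> int p dvd c - 1" using that by (intro not_dvd_residue) (auto simp: S_def cubes_def)
    then have "\<not> int p dvd 1 - c" by (metis dvd_diff_commute)
    then show ?thesis by (rule chi_power_3)
  qed
  ultimately obtain A B C :: nat where
    sum: "(\<Sum>c\<in>S. \<chi> (1 - c)) = of_nat A + of_nat B * \<omega> + of_nat C * \<omega>\<^sup>2" and
    prod: "(\<Prod>c\<in>S. \<chi> (1 - c)) = \<omega> ^ (B + 2 * C)"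
    using sum_prod_cube_roots_of_unity[of S "\<lambda>c. \<chi> (1 - c)"] by blast
  have "\<chi> 3 * \<chi> (int (card cubes)) = 1"
  proof -
    have "3 * int (card cubes) = int p - 1" using card_cubes p_gt_1 by linarith
    then have "[3 * int (card cubes) = - 1] (mod int p)" by (simp add: cong_iff_dvd_diff)
    then have "\<chi> (3 * int (card cubes)) = \<chi> (- 1)" by (rule chi_cong)
    then show ?thesis by (simp add: chi_mult[symmetric])
  qed
  then have "\<chi> (int (card cubes)) = 1" using assms by simp
  then have "\<omega> ^ (B + 2 * C) = 1"
    using chi_cong[OF prod_one_minus_cubes] by (simp add: prod[symmetric] chi_prod S_def)
  then have "3 dvd B + 2 * C" by (simp add: omega_power_eq_one_iff)
  then have "3 dvd int B - int C" by presburger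
  then obtain M where M: "int B - int C = 3 * M" by blast
  have "(\<Sum>c\<in>cubes. \<chi> (1 - c)) = (\<Sum>c\<in>S. \<chi> (1 - c))"
    unfolding S_def using one_in_cubes finite_cubes by (simp add: sum.remove)
  then have "jacobi_sum = 2 + 3 * (of_nat A + of_nat B * \<omega> + of_nat C * (- 1 - \<omega>))"
    by (simp add: jacobi_sum_eq sum omega_square)
  also have "\<dots> = of_int (2 + 3 * int A - 3 * int C) + of_int (3 * (int B - int C)) * \<omega>"
    by (simp add: algebra_simps)
  finally have "4 * int p = (2 * (2 + 3 * int A - 3 * int C) - 3 * (int B - int C))\<^sup>2
      + 3 * (3 * (int B - int C))\<^sup>2"
    using jacobi_sum_norm by (intro norm_of_eisenstein_integer) simp
  also have "3 * (3 * (int B - int C))\<^sup>2 = 243 * M\<^sup>2"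
    by (simp add: M power2_eq_square)
  finally show ?thesis by blast
qed

end

section \<open>Two classes of forms of discriminant -243\<close>

text \<open>
  In Brahmagupta's identity for \<open>28 p \<cdot> 4 p = 112 p\<^sup>2\<close> both terms are divisible by \<open>p\<^sup>2\<close>, so
  \<open>112 = s\<^sup>2 + 243 k\<^sup>2\<close>. This forces \<open>k = 0\<close>, but \<open>112\<close> is not a square.
\<close>
lemma forms_disjoint_aux:
  fixes p L M u y :: int
  assumes "Factorial_Ring.prime p" and "4 * p = L\<^sup>2 + 243 * M\<^sup>2" and "28 * p = u\<^sup>2 + 243 * y\<^sup>2"
    and "p dvd u * M - L * y"
  shows False
proof -
  from assms(4) obtain k where k: "u * M - L * y = p * k" by blast
  have "(u * L + 243 * M * y)\<^sup>2 + 243 * (u * M - L * y)\<^sup>2 = (u\<^sup>2 + 243 * y\<^sup>2) * (L\<^sup>2 + 243 * M\<^sup>2)"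
    by (simp add: power2_eq_square algebra_simps)
  then have eq: "(u * L + 243 * M * y)\<^sup>2 + 243 * (p * k)\<^sup>2 = 112 * p\<^sup>2"
    unfolding k assms(2,3)[symmetric] by (simp add: power2_eq_square)
  then have "(u * L + 243 * M * y)\<^sup>2 = p * (112 * p - 243 * p * k\<^sup>2)"
    by (simp add: power2_eq_square algebra_simps)
  then have "p dvd (u * L + 243 * M * y)\<^sup>2" by simp
  then have "p dvd u * L + 243 * M * y" using assms(1) prime_dvd_power by blast
  then obtain s where s: "u * L + 243 * M * y = p * s" by blast
  have "p\<^sup>2 * (s\<^sup>2 + 243 * k\<^sup>2) = p\<^sup>2 * 112"
    using eq unfolding s by (simp add: power2_eq_square algebra_simps)
  then have sk: "s\<^sup>2 + 243 * k\<^sup>2 = 112" using assms(1) by simp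
  have "k = 0"
  proof (rule ccontr)
    assume "k \<noteq> 0"
    then have "k\<^sup>2 > 0" by simp
    moreover have "s\<^sup>2 \<ge> 0" by simp
    ultimately show False using sk by linarith
  qed
  then have "\<bar>s\<bar>\<^sup>2 = 112" using sk by simp
  moreover have "\<bar>s\<bar> \<le> 10 \<or> \<bar>s\<bar> \<ge> 11" by linarith
  ultimately show False
    using power_mono[of "\<bar>s\<bar>" 10 2] power_mono[of 11 "\<bar>s\<bar>" 2] by auto
qed

text \<open>
  Completing the square turns the form into \<open>28 p = u\<^sup>2 + 243 y\<^sup>2\<close>. Since \<open>p\<close> divides
  \<open>(u M)\<^sup>2 - (L y)\<^sup>2\<close>, it divides one of the factors, and the sign of \<open>L\<close> is free.
\<close>
lemma forms_disjoint:
  fixes p L M x y :: int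
  assumes "Factorial_Ring.prime p" and "4 * p = L\<^sup>2 + 243 * M\<^sup>2"
    and "p = 7 * x\<^sup>2 + 3 * x * y + 9 * y\<^sup>2"
  shows False
proof -
  define u where "u = 14 * x + 3 * y"
  have u: "28 * p = u\<^sup>2 + 243 * y\<^sup>2"
    using assms(3) by (simp add: u_def power2_eq_square algebra_simps)
  have "(u * M - L * y) * (u * M - (- L) * y)
      = (u\<^sup>2 + 243 * y\<^sup>2) * M\<^sup>2 - (L\<^sup>2 + 243 * M\<^sup>2) * y\<^sup>2"
    by (simp add: power2_eq_square algebra_simps)
  also have "\<dots> = p * (28 * M\<^sup>2 - 4 * y\<^sup>2)"
    unfolding u[symmetric] assms(2)[symmetric] by (simp add: algebra_simps)
  finally have "p dvd u * M - L * y \<or> p dvd u * M - (- L) * y"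
    using assms(1) prime_dvd_multD by (metis dvd_triv_left)
  then show False
    using forms_disjoint_aux[OF assms(1,2) u] forms_disjoint_aux[OF assms(1) _ u, of "- L" M] assms(2)
    by auto
qed

section \<open>Gauss's lemma for monic factors\<close>

lemma clear_denominators:
  fixes g :: "rat poly"
  shows "\<exists>(d::int) G. d > 0 \<and> smult (of_int d) g = map_poly of_int G"
proof (induction g)
  case 0
  show ?case by (intro exI[of _ 1] exI[of _ 0]) simp
next
  case (pCons a g)
  then obtain d G where dG: "d > (0::int)" "smult (of_int d) g = map_poly of_int G" by blast
  obtain m n where mn: "a = of_int m / of_int n" "n > 0" by (cases a) (auto simp: Fract_of_int_quotient)
  have "smult (of_int (n * d)) g = smult (of_int n) (map_poly of_int G)"
    by (simp flip: dG(2))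
  also have "\<dots> = map_poly of_int (smult n G)"
    by (simp add: poly_eq_iff coeff_map_poly)
  finally have "smult (of_int (n * d)) (pCons a g) = map_poly of_int (pCons (m * d) (smult n G))"
    using mn by (simp add: map_poly_pCons)
  then show ?case using dG(1) mn(2) by (intro exI[of _ "n * d"] exI) auto
qed

lemma map_poly_of_int_mult:
  "map_poly of_int (f * g) = (map_poly of_int f * map_poly of_int g :: rat poly)"
  by (rule poly_eqI) (simp add: coeff_map_poly coeff_mult)

lemma map_poly_of_int_inject:
  "map_poly of_int f = (map_poly of_int g :: rat poly) \<longleftrightarrow> f = g"
  by (auto simp: poly_eq_iff coeff_map_poly)

text \<open>
  Clear denominators: \<open>G = d g\<close> and \<open>H = e h\<close> are integral with leading coefficients \<open>d, e\<close>,
  so their contents divide \<open>d\<close> and \<open>e\<close>. As contents are multiplicative and \<open>G H = d e f\<close>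
  has content \<open>d e\<close>, the content of \<open>G\<close> is \<open>d\<close>, i.e. \<open>d\<close> divides all coefficients of \<open>d g\<close>.
\<close>
lemma monic_rat_factor_of_monic_int_poly:
  fixes f :: "int poly" and g h :: "rat poly"
  assumes "lead_coeff f = 1" "lead_coeff g = 1" "map_poly of_int f = g * h"
  shows "Polynomial.coeff g i \<in> \<int>"
proof -
  have "lead_coeff (map_poly of_int f :: rat poly) = 1"
    using assms(1) by (simp add: coeff_map_poly degree_map_poly)
  then have lh: "lead_coeff h = 1" using assms(2,3) by (simp add: lead_coeff_mult)
  obtain d G where dG: "d > (0::int)" "smult (of_int d) g = map_poly of_int G"
    using clear_denominators by blast
  obtain e H where eH: "e > (0::int)" "smult (of_int e) h = map_poly of_int H"
    using clear_denominators by blast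
  have coeff_G: "of_int (Polynomial.coeff G j) = of_int d * Polynomial.coeff g j" for j
    using dG(2) by (metis coeff_map_poly coeff_smult of_int_0)
  have coeff_H: "of_int (Polynomial.coeff H j) = of_int e * Polynomial.coeff h j" for j
    using eH(2) by (metis coeff_map_poly coeff_smult of_int_0)
  have "(of_int (Polynomial.coeff G (degree g)) :: rat) = of_int d"
    using coeff_G[of "degree g"] assms(2) by simp
  then have cG: "content G dvd d" using content_dvd_coeff[of G "degree g"] by simp
  have "(of_int (Polynomial.coeff H (degree h)) :: rat) = of_int e"
    using coeff_H[of "degree h"] lh by simp
  then have cH: "content H dvd e" using content_dvd_coeff[of H "degree h"] by simp
  have "map_poly of_int (G * H) = smult (of_int d) g * smult (of_int e) h"
    by (simp only: map_poly_of_int_mult dG(2) eH(2))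
  also have "\<dots> = smult (of_int (d * e)) (map_poly of_int f)"
    by (simp add: assms(3) mult.commute)
  also have "\<dots> = map_poly of_int (smult (d * e) f)"
    by (simp add: poly_eq_iff coeff_map_poly)
  finally have "G * H = smult (d * e) f" by (simp only: map_poly_of_int_inject)
  moreover have "content f = 1"
    using content_dvd_coeff[of f "degree f"] assms(1) by (simp add: content_def)
  ultimately have prod: "content G * content H = d * e"
    using content_mult[of G H] dG(1) eH(1) by (simp add: content_smult abs_mult)
  obtain m where m: "d = content G * m" using cG by blast
  have "content G \<noteq> 0" using m dG(1) by auto
  then have "content H = m * e" using prod m by simp
  then have "m * e dvd 1 * e" using cH by simp
  then have "m dvd 1" using eH(1) by (subst (asm) dvd_mult_cancel_right) auto
  then have "d dvd content G" using m by (simp add: mult_unit_dvd_iff)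
  then have "d dvd Polynomial.coeff G i" using content_dvd_coeff dvd_trans by blast
  then obtain k where "Polynomial.coeff G i = d * k" by blast
  then have "Polynomial.coeff g i = of_int k" using coeff_G[of i] dG(1) by simp
  then show ?thesis by simp
qed

definition eval_rat_poly :: "rat poly \<Rightarrow> real \<Rightarrow> real" where
  "eval_rat_poly q x = poly (map_poly of_rat q) x"

lemma eval_rat_poly_0 [simp]: "eval_rat_poly 0 x = 0"
  by (simp add: eval_rat_poly_def)

lemma eval_rat_poly_pCons [simp]:
  "eval_rat_poly (pCons a q) x = of_rat a + x * eval_rat_poly q x"
  by (simp add: eval_rat_poly_def map_poly_pCons)

lemma eval_rat_poly_add: "eval_rat_poly (q + r) x = eval_rat_poly q x + eval_rat_poly r x"
  by (induction q r rule: poly_induct2) (simp_all add: of_rat_add algebra_simps)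

lemma eval_rat_poly_smult: "eval_rat_poly (smult a q) x = of_rat a * eval_rat_poly q x"
  by (induction q) (simp_all add: of_rat_mult algebra_simps)

lemma eval_rat_poly_mult: "eval_rat_poly (q * r) x = eval_rat_poly q x * eval_rat_poly r x"
  by (induction q) (simp_all add: eval_rat_poly_add eval_rat_poly_smult algebra_simps)

lemma eval_rat_poly_of_int: "eval_rat_poly (map_poly of_int f) x = poly (map_poly of_int f) x"
  by (simp add: eval_rat_poly_def map_poly_map_poly o_def)

text \<open>
  A cube of a denominator cannot be cancelled by the square of a prime.
\<close>
lemma rat_int_if_prime_square_mult_cube:
  fixes r :: rat
  assumes "Factorial_Ring.prime (p::int)" "of_int (p\<^sup>2) * r ^ 3 \<in> \<int>"
  shows "r \<in> \<int>"
proof -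
  obtain x y where xy: "r = of_int x / of_int y" "y > 0" "Rings.coprime x y"
    by (cases r) (auto simp: Fract_of_int_quotient)
  obtain k where "of_int (p\<^sup>2) * r ^ 3 = of_int k" using assms(2) by (auto elim: Ints_cases)
  then have "(of_int (p\<^sup>2 * x ^ 3) :: rat) = of_int (k * y ^ 3)"
    using xy(1,2) by (simp add: field_simps)
  then have "p\<^sup>2 * x ^ 3 = k * y ^ 3" by (simp only: of_int_eq_iff)
  then have "y ^ 3 dvd p\<^sup>2 * x ^ 3" by simp
  moreover have "Rings.coprime (y ^ 3) (x ^ 3)" using xy(3) by (simp add: Rings.coprime_commute)
  ultimately have yp: "y ^ 3 dvd p\<^sup>2" using coprime_dvd_mult_left_iff by blast
  have "is_unit y"
  proof (rule ccontr)
    assume "\<not> is_unit y"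
    then obtain q where q: "Factorial_Ring.prime q" "q dvd y"
      using xy(2) prime_divisor_exists[of y] by blast
    have q3: "q ^ 3 dvd p\<^sup>2" using dvd_power_same[OF q(2), of 3] yp by (rule dvd_trans)
    have "q dvd q ^ 3" by (simp add: power3_eq_cube)
    then have "q dvd p\<^sup>2" using q3 by (rule dvd_trans)
    then have "q dvd p" using q(1) prime_dvd_power by blast
    then have "q = p" using q(1) assms(1) primes_dvd_imp_eq by blast
    then have "p ^ 3 dvd p\<^sup>2" using q3 by simp
    moreover have p1: "p > 1" using assms(1) prime_gt_1_int by blast
    ultimately have "p ^ 3 \<le> p\<^sup>2" by (intro zdvd_imp_le) auto
    then show False using power_strict_increasing[of 2 3 p] p1 by simp
  qed
  then show ?thesis using xy(1,2) by simp
qed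

section \<open>Generated subrings and subfields\<close>

lemma ring_of_type_algebra_simps [simp]:
  "carrier ring_of_type_algebra = UNIV" "\<one>\<^bsub>ring_of_type_algebra\<^esub> = 1" "\<zero>\<^bsub>ring_of_type_algebra\<^esub> = 0"
  "x \<oplus>\<^bsub>ring_of_type_algebra\<^esub> y = x + y" "x \<otimes>\<^bsub>ring_of_type_algebra\<^esub> y = x * y"
  by (simp_all add: ring_of_type_algebra_def)

lemma a_inv_ring_of_type_algebra [simp]:
  "\<ominus>\<^bsub>ring_of_type_algebra\<^esub> x = - (x :: 'a :: comm_ring_1)"
proof -
  interpret R: Ring.ring "ring_of_type_algebra :: 'a Ring.ring" by (rule ring_from_type_algebra)
  show ?thesis by (rule R.minus_equality) simp_all
qed

lemma m_inv_ring_of_type_algebra: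
  fixes x :: "'a :: Fields.field"
  assumes "x \<noteq> 0"
  shows "inv\<^bsub>ring_of_type_algebra\<^esub> x = inverse x"
proof -
  interpret R: Ring.field "ring_of_type_algebra :: 'a Ring.ring" by (rule field_from_type_algebra)
  have "inverse x = inv\<^bsub>ring_of_type_algebra\<^esub> x"
    by (rule R.inv_unique') (use assms in simp_all)
  then show ?thesis by simp
qed

lemma rat_adjoin_intros:
  "1 \<in> rat_adjoin S"
  "x \<in> S \<Longrightarrow> x \<in> rat_adjoin S"
  "x \<in> rat_adjoin S \<Longrightarrow> y \<in> rat_adjoin S \<Longrightarrow> x + y \<in> rat_adjoin S"
  "x \<in> rat_adjoin S \<Longrightarrow> y \<in> rat_adjoin S \<Longrightarrow> x * y \<in> rat_adjoin S"
  "x \<in> rat_adjoin S \<Longrightarrow> x \<noteq> 0 \<Longrightarrow> inverse x \<in> rat_adjoin S"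
  using generate_field.intros[where R = ring_of_type_algebra and H = S]
    generate_field.m_inv[where R = ring_of_type_algebra and H = S and h = x]
    m_inv_ring_of_type_algebra[of x]
  by (auto simp: rat_adjoin_def)

lemma rat_adjoin_induct [consumes 1, case_names one incl uminus inverse add mult]:
  assumes "x \<in> rat_adjoin S" "P 1" "\<And>x. x \<in> S \<Longrightarrow> P x" "\<And>x. P x \<Longrightarrow> P (- x)"
    "\<And>x. P x \<Longrightarrow> x \<noteq> 0 \<Longrightarrow> P (inverse x)"
    "\<And>x y. P x \<Longrightarrow> P y \<Longrightarrow> P (x + y)" "\<And>x y. P x \<Longrightarrow> P y \<Longrightarrow> P (x * y)"
  shows "P x"
  using assms(1) unfolding rat_adjoin_def
  by (induction rule: generate_field.induct)
    (use assms(2-) in \<open>simp_all add: m_inv_ring_of_type_algebra\<close>)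

lemma int_adjoin_induct [consumes 1, case_names one incl uminus add mult]:
  assumes "x \<in> int_adjoin S" "P 1" "\<And>x. x \<in> S \<Longrightarrow> P x" "\<And>x. P x \<Longrightarrow> P (- x)"
    "\<And>x y. P x \<Longrightarrow> P y \<Longrightarrow> P (x + y)" "\<And>x y. P x \<Longrightarrow> P y \<Longrightarrow> P (x * y)"
  shows "P x"
  using assms(1) unfolding int_adjoin_def
  by (induction rule: generate_ring.induct) (use assms(2-) in \<open>simp_all\<close>)

section \<open>Pure cubic fields\<close>

locale pure_cubic =
  fixes p :: nat and t :: real
  assumes prime_p: "Factorial_Ring.prime p" and cube: "t ^ 3 = real p"
begin

text \<open>
  In other words, \<open>p\<close> is not a rational cube.
\<close>
lemma cube_eq_p_times_cube:
  fixes b c :: rat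
  assumes "b ^ 3 = of_nat p * c ^ 3"
  shows "b = 0 \<and> c = 0"
proof (cases "c = 0")
  case False
  have prime: "Factorial_Ring.prime (int p)" using prime_p by simp
  have r: "(b / c) ^ 3 = of_nat p" using assms False by (simp add: power_divide)
  then have "of_int ((int p)\<^sup>2) * (b / c) ^ 3 \<in> \<int>" by simp
  then have "b / c \<in> \<int>" by (rule rat_int_if_prime_square_mult_cube[OF prime])
  then obtain k where "b / c = of_int k" by (auto elim: Ints_cases)
  then have "(of_int (k ^ 3) :: rat) = of_int (int p)" using r by simp
  then have k: "k ^ 3 = int p" by (simp only: of_int_eq_iff)
  then have "int p dvd k ^ 3" by simp
  then have "int p dvd k" using prime prime_dvd_power by blast
  then obtain m where "k = int p * m" by blast
  then have "int p * ((int p * m ^ 3) * int p) = int p * 1"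
    using k by (simp add: power3_eq_cube mult_ac)
  then have "(int p * m ^ 3) * int p = 1" using prime by (simp only: mult_cancel_left) auto
  then have "int p dvd 1" by (metis dvd_triv_right)
  then show ?thesis using prime not_prime_unit by blast
qed (use assms in simp)

lemma t_irrational: "t \<noteq> of_rat r"
proof
  assume "t = of_rat r"
  then have "(of_rat (r ^ 3) :: real) = of_rat (of_nat p)" using cube by (simp add: of_rat_power)
  then have "r ^ 3 = of_nat p * 1 ^ 3" by (simp only: of_rat_eq_iff) simp
  then show False using cube_eq_p_times_cube by fastforce
qed

definition el :: "rat \<Rightarrow> rat \<Rightarrow> rat \<Rightarrow> real" where
  "el a b c = of_rat a + of_rat b * t + of_rat c * t\<^sup>2"

lemmas of_rat_simps = of_rat_add of_rat_diff of_rat_mult of_rat_minus of_rat_power of_rat_divide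

lemma el_mult:
  "el a b c * el a' b' c' =
     el (a * a' + of_nat p * (b * c' + c * b')) (a * b' + b * a' + of_nat p * (c * c')) (a * c' + b * b' + c * a')"
  by (simp add: el_def of_rat_simps cube[symmetric] algebra_simps power2_eq_square power3_eq_cube)

lemma el_add: "el a b c + el a' b' c' = el (a + a') (b + b') (c + c')"
  by (simp add: el_def of_rat_simps algebra_simps)

lemma el_uminus: "- el a b c = el (- a) (- b) (- c)"
  by (simp add: el_def of_rat_simps)

lemma el_of_rat: "of_rat r = el r 0 0"
  by (simp add: el_def)

lemma el_scale: "of_rat r * el a b c = el (r * a) (r * b) (r * c)"
  by (simp add: el_def of_rat_simps algebra_simps)

text \<open>
  A relation \<open>a + b t + c t\<^sup>2 = 0\<close> times \<open>c t - b\<close> is linear in \<open>t\<close>. As \<open>t\<close> is irrational, both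
  of its coefficients vanish, and together they give \<open>b\<^sup>3 = p c\<^sup>3\<close>.
\<close>
lemma el_eq_0_iff: "el a b c = 0 \<longleftrightarrow> a = 0 \<and> b = 0 \<and> c = 0"
proof
  assume z: "el a b c = 0"
  have "of_rat (c * a - b\<^sup>2) * t + of_rat (of_nat p * c\<^sup>2 - a * b) =
      (of_rat c * t - of_rat b) * el a b c"
    by (simp add: el_def of_rat_simps cube[symmetric] algebra_simps power2_eq_square power3_eq_cube)
  then have lin: "of_rat (c * a - b\<^sup>2) * t + of_rat (of_nat p * c\<^sup>2 - a * b) = 0"
    using z by simp
  have ca: "c * a - b\<^sup>2 = 0"
  proof (rule ccontr)
    assume nz: "c * a - b\<^sup>2 \<noteq> 0"
    then have "t = of_rat (- (of_nat p * c\<^sup>2 - a * b) / (c * a - b\<^sup>2))"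
      using lin by (simp only: of_rat_divide of_rat_minus) (simp add: field_simps add_eq_0_iff2)
    then show False using t_irrational by blast
  qed
  then have ab: "of_nat p * c\<^sup>2 = a * b" using lin by simp
  have "b ^ 3 = b * (c * a)" using ca by (simp add: power2_eq_square power3_eq_cube)
  also have "\<dots> = of_nat p * c ^ 3" using ab by (simp add: power2_eq_square power3_eq_cube mult_ac)
  finally have "b = 0 \<and> c = 0" by (rule cube_eq_p_times_cube)
  with z show "a = 0 \<and> b = 0 \<and> c = 0" by (simp add: el_def)
qed (simp add: el_def)

lemma el_eq_iff: "el a b c = el a' b' c' \<longleftrightarrow> a = a' \<and> b = b' \<and> c = c'"
proof -
  have "el a b c = el a' b' c' \<longleftrightarrow> el (a - a') (b - b') (c - c') = 0"
    by (simp add: el_def of_rat_simps algebra_simps)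
  then show ?thesis by (simp add: el_eq_0_iff)
qed

text \<open>
  This and the next two definitions are the elementary symmetric functions of
  \<open>a + b t + c t\<^sup>2\<close> and its two conjugates, obtained from it by replacing \<open>t\<close> with \<open>\<omega> t\<close> and \<open>\<omega>\<^sup>2 t\<close>.
\<close>
definition trace :: "rat \<Rightarrow> rat" where "trace a = 3 * a"

definition sigma2 :: "rat \<Rightarrow> rat \<Rightarrow> rat \<Rightarrow> rat" where
  "sigma2 a b c = 3 * (a\<^sup>2 - of_nat p * b * c)"

definition norm_el :: "rat \<Rightarrow> rat \<Rightarrow> rat \<Rightarrow> rat" where
  "norm_el a b c = a ^ 3 + of_nat p * b ^ 3 + (of_nat p)\<^sup>2 * c ^ 3 - 3 * of_nat p * a * b * c"

lemma characteristic_equation: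
  "el a b c ^ 3 = of_rat (trace a) * (el a b c)\<^sup>2 - of_rat (sigma2 a b c) * el a b c + of_rat (norm_el a b c)"
  by (simp add: el_def trace_def sigma2_def norm_el_def of_rat_simps cube[symmetric]
      algebra_simps power2_eq_square power3_eq_cube)

text \<open>
  The second factor is the product of the two conjugates of the first.
\<close>
lemma el_mult_adjugate:
  "el a b c * el (a\<^sup>2 - of_nat p * b * c) (of_nat p * c\<^sup>2 - a * b) (b\<^sup>2 - a * c) = of_rat (norm_el a b c)"
  by (simp add: el_def norm_el_def of_rat_simps cube[symmetric]
      algebra_simps power2_eq_square power3_eq_cube)

lemma el_inverse:
  assumes "el a b c \<noteq> 0"
  shows "inverse (el a b c) \<in> {el x y z | x y z. True}"
proof -
  let ?N = "norm_el a b c" and ?adj = "el (a\<^sup>2 - of_nat p * b * c) (of_nat p * c\<^sup>2 - a * b) (b\<^sup>2 - a * c)"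
  have "?N \<noteq> 0"
  proof
    assume "?N = 0"
    then have "?adj = 0" using assms el_mult_adjugate[of a b c] by simp
    then have eqs: "a\<^sup>2 = of_nat p * b * c" "of_nat p * c\<^sup>2 = a * b" "b\<^sup>2 = a * c"
      by (simp_all add: el_eq_0_iff)
    have "b ^ 3 = b * (a * c)" using eqs(3) by (simp add: power2_eq_square power3_eq_cube)
    also have "\<dots> = of_nat p * c ^ 3"
      using eqs(2) by (simp add: power2_eq_square power3_eq_cube mult_ac)
    finally have "b = 0 \<and> c = 0" by (rule cube_eq_p_times_cube)
    with eqs(1) assms show False by (simp add: el_eq_0_iff)
  qed
  then have "el a b c * (of_rat (1 / ?N) * ?adj) = 1"
    using el_mult_adjugate[of a b c] by (simp add: of_rat_divide mult_ac)
  then have "inverse (el a b c) = of_rat (1 / ?N) * ?adj" by (rule inverse_unique)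
  then show ?thesis unfolding el_scale by blast
qed

lemma rat_adjoin_t:
  assumes "x \<in> rat_adjoin {t}"
  shows "\<exists>a b c. x = el a b c"
  using assms
proof (induction rule: rat_adjoin_induct)
  case one
  then show ?case using el_of_rat[of 1] by auto
next
  case (incl x)
  then have "x = el 0 1 0" by (simp add: el_def)
  then show ?case by blast
next
  case (uminus x)
  then show ?case using el_uminus by metis
next
  case (inverse x)
  then show ?case using el_inverse by blast
next
  case (add x y)
  then show ?case using el_add by metis
next
  case (mult x y)
  then show ?case using el_mult by metis
qed

text \<open>
  The characteristic polynomial \<open>g\<close> of an irrational \<open>\<alpha> = a + b t + c t\<^sup>2\<close> divides every rational polynomial
  \<open>F\<close> that vanishes at \<open>\<alpha>\<close>: the remainder has degree at most \<open>2\<close>, and \<open>1, \<alpha>, \<alpha>\<^sup>2\<close> are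
  independent, because their coordinates have determinant \<open>b\<^sup>3 - p c\<^sup>3 \<noteq> 0\<close>. Taking \<open>F\<close> monic
  with integer coefficients, Gauss's lemma applies to \<open>g\<close>.
\<close>
lemma characteristic_coefficients_integral:
  assumes "algebraic_int (el a b c)" "\<not> (b = 0 \<and> c = 0)"
  shows "trace a \<in> \<int>" "sigma2 a b c \<in> \<int>" "norm_el a b c \<in> \<int>"
proof -
  define x where "x = el a b c"
  obtain f :: "int poly" where f: "poly (map_poly of_int f) x = 0" "lead_coeff f = 1"
    using assms(1) unfolding x_def algebraic_int_altdef_ipoly by blast
  define F where "F = (map_poly of_int f :: rat poly)"
  define g where "g = [:- norm_el a b c, sigma2 a b c, - trace a, 1:]"
  have g0: "eval_rat_poly g x = 0"
    using characteristic_equation[of a b c]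
    by (simp add: g_def x_def of_rat_minus algebra_simps power2_eq_square power3_eq_cube)
  have "F = g * (F div g) + F mod g" by simp
  moreover have "eval_rat_poly F x = 0" using f(1) by (simp add: F_def eval_rat_poly_of_int)
  ultimately have r0: "eval_rat_poly (F mod g) x = 0"
    using g0 by (metis add_0 eval_rat_poly_add eval_rat_poly_mult mult_zero_left)
  have "g \<noteq> 0" "degree g = 3" by (simp_all add: g_def)
  then have "F mod g = 0 \<or> degree (F mod g) < 3" using degree_mod_less[of g F] by auto
  moreover have "F mod g = 0" if "degree (F mod g) < 3"
  proof -
    define u v w where "u = Polynomial.coeff (F mod g) 0" and "v = Polynomial.coeff (F mod g) 1"
      and "w = Polynomial.coeff (F mod g) 2"
    have "F mod g = [:u, v, w:]"
    proof (rule poly_eqI)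
      fix n
      show "Polynomial.coeff (F mod g) n = Polynomial.coeff [:u, v, w:] n"
      proof (cases "n < 3")
        case True
        then have "n = 0 \<or> n = 1 \<or> n = 2" by linarith
        then show ?thesis by (auto simp: u_def v_def w_def numeral_2_eq_2)
      next
        case False
        then have "Polynomial.coeff (F mod g) n = 0" using that by (intro coeff_eq_0) simp
        moreover have "Polynomial.coeff [:u, v, w:] n = 0"
          using False by (intro coeff_eq_0) (auto intro: le_less_trans[OF degree_pCons_le])
        ultimately show ?thesis by simp
      qed
    qed
    then have "of_rat u + of_rat v * x + of_rat w * (x * x) = 0"
      using r0 by (simp add: algebra_simps)
    then have "el (u + v * a + w * (a * a + of_nat p * (b * c + c * b)))
        (v * b + w * (a * b + b * a + of_nat p * (c * c))) (v * c + w * (a * c + b * b + c * a)) = 0"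
      by (simp add: x_def el_mult el_scale el_add el_of_rat)
    then have eqs: "u + v * a + w * (a * a + of_nat p * (b * c + c * b)) = 0"
        "v * b + w * (a * b + b * a + of_nat p * (c * c)) = 0"
        "v * c + w * (a * c + b * b + c * a) = 0"
      by (simp_all add: el_eq_0_iff)
    \<comment> \<open>Eliminating \<open>v\<close> from the last two equations leaves \<open>w\<close> times the determinant.\<close>
    have "w * (b ^ 3 - of_nat p * c ^ 3)
        = b * (v * c + w * (a * c + b * b + c * a)) - c * (v * b + w * (a * b + b * a + of_nat p * (c * c)))"
      by (simp add: algebra_simps power3_eq_cube)
    also have "\<dots> = 0" by (simp only: eqs mult_zero_right diff_0)
    finally have "w = 0 \<or> b ^ 3 = of_nat p * c ^ 3" by simp
    then have "w = 0" using assms(2) cube_eq_p_times_cube by blast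
    moreover then have "v = 0" using eqs(2,3) assms(2) by auto
    ultimately have "u = 0" using eqs(1) by simp
    with \<open>w = 0\<close> \<open>v = 0\<close> \<open>F mod g = [:u, v, w:]\<close> show ?thesis by simp
  qed
  ultimately have "F = g * (F div g)" using \<open>F = g * (F div g) + F mod g\<close> by auto
  then have "Polynomial.coeff g i \<in> \<int>" for i
    by (intro monic_rat_factor_of_monic_int_poly[OF f(2)]) (simp_all add: F_def g_def)
  from this[of 0] this[of 1] this[of 2] show "trace a \<in> \<int>" "sigma2 a b c \<in> \<int>" "norm_el a b c \<in> \<int>"
    by (simp_all add: g_def numeral_2_eq_2 minus_in_Ints_iff)
qed

end

lemma int_cube_cong_mod_3: "[x ^ 3 = x] (mod (3::int))"
proof -
  have "x ^ 3 - x = (x - 1) * x * (x + 1)" by (simp add: algebra_simps power3_eq_cube)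
  moreover have "3 dvd x - 1 \<or> 3 dvd x \<or> 3 dvd x + 1" by presburger
  ultimately have "3 dvd x ^ 3 - x" by auto
  then show ?thesis by (simp add: cong_iff_dvd_diff)
qed

text \<open>
  Modulo \<open>3\<close> the cubic hypothesis reads \<open>A + B + C \<equiv> 0\<close>, by Fermat. Eliminating \<open>A\<close> from
  \<open>A\<^sup>2 \<equiv> B C\<close> leaves \<open>(B - C)\<^sup>2 \<equiv> 0\<close>.
\<close>
lemma coordinates_cong_mod_3:
  fixes A B C p :: int
  assumes "[p = 1] (mod 3)" "3 dvd A\<^sup>2 - p * B * C"
    "3 dvd A ^ 3 + p * B ^ 3 + p\<^sup>2 * C ^ 3 - 3 * p * A * B * C"
  shows "3 dvd B - C"
proof -
  obtain k where p: "p = 1 + 3 * k" using assms(1) by (metis cong_iff_lin cong_sym mult.commute)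
  have "A ^ 3 + p * B ^ 3 + p\<^sup>2 * C ^ 3 - 3 * p * A * B * C
      = (A ^ 3 + B ^ 3 + C ^ 3) + 3 * (k * B ^ 3 + (2 * k + 3 * k\<^sup>2) * C ^ 3 - p * A * B * C)"
    by (simp add: p algebra_simps power2_eq_square)
  then have "3 dvd A ^ 3 + B ^ 3 + C ^ 3" using assms(3) by (metis dvd_add_left_iff dvd_triv_left)
  moreover have "[A ^ 3 + B ^ 3 + C ^ 3 = A + B + C] (mod 3)"
    by (intro cong_add int_cube_cong_mod_3)
  ultimately have "3 dvd A + B + C" by (simp add: cong_dvd_iff)
  then obtain j where "A + B + C = 3 * j" by blast
  then have A: "A = 3 * j - B - C" by simp
  have "A\<^sup>2 - p * B * C = (B - C)\<^sup>2 + 3 * (3 * j\<^sup>2 - 2 * j * (B + C) + B * C - k * B * C)"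
    by (simp add: A p algebra_simps power2_eq_square)
  then have "3 dvd (B - C)\<^sup>2" using assms(2) by (metis dvd_add_left_iff dvd_triv_left)
  then show ?thesis using prime_dvd_power[of 3 "B - C" 2] by simp
qed

context pure_cubic
begin

lemma prime_int: "Factorial_Ring.prime (int p)"
  using prime_p by simp

text \<open>
  Integrality of the trace and of the second symmetric function makes \<open>9 p b c\<close> an integer,
  and that of the norm then makes the sum of \<open>u = p (3 b)\<^sup>3\<close> and \<open>v = p\<^sup>2 (3 c)\<^sup>3\<close> one. Their
  product is \<open>(9 p b c)\<^sup>3\<close>, so the rational numbers \<open>u\<close> and \<open>v\<close> are roots of a monic integral
  quadratic, hence integers, and so are \<open>3 b\<close> and \<open>3 c\<close>.
\<close>
lemma algebraic_int_coordinates: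
  assumes "algebraic_int (el a b c)" "\<not> (b = 0 \<and> c = 0)" "[p = 1] (mod 3)"
  obtains B C :: int where "b = of_int B / 3" "c = of_int C / 3" "3 dvd B - C"
proof -
  note ints = characteristic_coefficients_integral[OF assms(1,2)]
  obtain A where A: "3 * a = of_int A" using ints(1) by (auto simp: trace_def elim: Ints_cases)
  obtain E where E: "3 * (a\<^sup>2 - of_nat p * b * c) = of_int E"
    using ints(2) by (auto simp: sigma2_def elim: Ints_cases)
  obtain N where N: "a ^ 3 + of_nat p * b ^ 3 + (of_nat p)\<^sup>2 * c ^ 3 - 3 * of_nat p * a * b * c = of_int N"
    using ints(3) by (auto simp: norm_el_def elim: Ints_cases)
  define u v where "u = of_nat p * (3 * b) ^ 3" and "v = (of_nat p)\<^sup>2 * (3 * c) ^ 3"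
  define m s where "m = A\<^sup>2 - 3 * E" and "s = 27 * N - A ^ 3 + 3 * A * m"
  have m: "of_nat p * (3 * b) * (3 * c) = of_int m"
    by (simp add: m_def A[symmetric] E[symmetric] algebra_simps power2_eq_square)
  have "u + v = 27 * of_int N - (3 * a) ^ 3 + 3 * (3 * a) * (of_nat p * (3 * b) * (3 * c))"
    by (simp add: u_def v_def N[symmetric] algebra_simps power2_eq_square power3_eq_cube)
  also have "\<dots> = of_int s" by (simp only: m A) (simp add: s_def)
  finally have uv: "u + v = of_int s" .
  have "u * v = (of_nat p * (3 * b) * (3 * c)) ^ 3"
    by (simp add: u_def v_def power2_eq_square power3_eq_cube)
  then have uvm: "u * v = of_int (m ^ 3)" by (simp add: m)
  have integral: "z \<in> \<int>" if "z = u \<or> z = v" for z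
  proof -
    have "(z - u) * (z - v) = 0" using that by auto
    then have "z * z - (u + v) * z + u * v = 0" by (simp add: algebra_simps)
    then have "z * z - of_int s * z + of_int (m ^ 3) = 0" by (simp only: uv uvm)
    then have "poly (map_poly of_int [:m ^ 3, - s, 1:]) z = 0"
      by (simp add: map_poly_pCons algebra_simps)
    then have "algebraic_int z"
      unfolding algebraic_int_altdef_ipoly by (intro exI[of _ "[:m ^ 3, - s, 1:]"]) simp
    then show ?thesis by (rule rational_algebraic_int_is_int) (simp add: Rats_def)
  qed
  have "of_int ((int p)\<^sup>2) * (3 * b) ^ 3 = of_nat p * u" by (simp add: u_def power2_eq_square)
  then have "of_int ((int p)\<^sup>2) * (3 * b) ^ 3 \<in> \<int>" using integral[of u] by simp
  then have "3 * b \<in> \<int>" by (rule rat_int_if_prime_square_mult_cube[OF prime_int])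
  then obtain B where B: "3 * b = of_int B" by (auto elim: Ints_cases)
  have "of_int ((int p)\<^sup>2) * (3 * c) ^ 3 \<in> \<int>" using integral[of v] by (simp add: v_def)
  then have "3 * c \<in> \<int>" by (rule rat_int_if_prime_square_mult_cube[OF prime_int])
  then obtain C where C: "3 * c = of_int C" by (auto elim: Ints_cases)
  have "of_int (A\<^sup>2 - int p * B * C) = (of_int (3 * E) :: rat)"
    by (simp add: A[symmetric] B[symmetric] C[symmetric] E[symmetric] algebra_simps power2_eq_square)
  then have 1: "A\<^sup>2 - int p * B * C = 3 * E" by (simp only: of_int_eq_iff)
  have "of_int (A ^ 3 + int p * B ^ 3 + (int p)\<^sup>2 * C ^ 3 - 3 * int p * A * B * C) = (of_int (27 * N) :: rat)"
    by (simp add: A[symmetric] B[symmetric] C[symmetric] N[symmetric] algebra_simps power2_eq_square power3_eq_cube)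
  then have "A ^ 3 + int p * B ^ 3 + (int p)\<^sup>2 * C ^ 3 - 3 * int p * A * B * C = 27 * N"
    by (simp only: of_int_eq_iff)
  then have 2: "3 dvd A ^ 3 + int p * B ^ 3 + (int p)\<^sup>2 * C ^ 3 - 3 * int p * A * B * C" by simp
  have "[int p = 1] (mod 3)" using assms(3) by (metis cong_int_iff of_nat_1 of_nat_numeral)
  then have "3 dvd B - C" by (rule coordinates_cong_mod_3[OF _ _ 2]) (simp add: 1)
  moreover have "b = of_int B / 3" "c = of_int C / 3" using B C by simp_all
  ultimately show ?thesis using that by blast
qed

section \<open>The index form and cubic residues\<close>

lemma monogenic_generator_not_rational:
  assumes "t \<in> int_adjoin {el a b c}"
  shows "\<not> (b = 0 \<and> c = 0)"
proof
  assume "b = 0 \<and> c = 0"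
  then have gen: "el a b c = of_rat a" by (simp add: el_def)
  from assms have "\<exists>r. t = of_rat r"
  proof (induction rule: int_adjoin_induct)
    case one
    show ?case by (rule exI[of _ 1]) simp
  qed (use gen in \<open>auto simp flip: of_rat_minus of_rat_add of_rat_mult\<close>)
  then show False using t_irrational by blast
qed

end

lemma quadratic_product_mod_cubic:
  fixes \<alpha> :: "'a :: comm_ring_1"
  assumes "\<alpha> ^ 3 = T * \<alpha>\<^sup>2 - E * \<alpha> + N"
  shows "(u + v * \<alpha> + w * \<alpha>\<^sup>2) * (u' + v' * \<alpha> + w' * \<alpha>\<^sup>2) =
      (u * u' + (v * w' + w * v') * N + w * w' * T * N)
      + (u * v' + v * u' - (v * w' + w * v') * E + w * w' * (N - T * E)) * \<alpha>
      + (u * w' + v * v' + w * u' + (v * w' + w * v') * T + w * w' * (T * T - E)) * \<alpha>\<^sup>2"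
    (is "?l = ?r")
proof -
  \<comment> \<open>The first factor is the quotient of the product by the cubic.\<close>
  have "?l - ?r = (v * w' + w * v' + w * w' * (\<alpha> + T)) * (\<alpha> ^ 3 - (T * \<alpha>\<^sup>2 - E * \<alpha> + N))"
    by (simp add: algebra_simps power2_eq_square power3_eq_cube)
  then show ?thesis by (simp only: assms diff_self mult_zero_right right_minus_eq)
qed

lemma int_adjoin_cubic:
  fixes \<alpha> :: "'a :: field_char_0"
  assumes "\<alpha> ^ 3 = of_int T * \<alpha>\<^sup>2 - of_int E * \<alpha> + of_int N" and "x \<in> int_adjoin {\<alpha>}"
  shows "\<exists>u v w :: int. x = of_int u + of_int v * \<alpha> + of_int w * \<alpha>\<^sup>2"
  using assms(2)
proof (induction rule: int_adjoin_induct)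
  case one
  show ?case by (rule exI[of _ 1], rule exI[of _ 0], rule exI[of _ 0]) simp
next
  case (incl x)
  then show ?case by (intro exI[of _ 0] exI[of _ 1]) simp
next
  case (uminus x)
  then obtain u v w :: int where "x = of_int u + of_int v * \<alpha> + of_int w * \<alpha>\<^sup>2" by blast
  then show ?case by (intro exI[of _ "- u"] exI[of _ "- v"] exI[of _ "- w"]) simp
next
  case (add x y)
  then obtain u v w u' v' w' :: int where "x = of_int u + of_int v * \<alpha> + of_int w * \<alpha>\<^sup>2"
    "y = of_int u' + of_int v' * \<alpha> + of_int w' * \<alpha>\<^sup>2" by blast
  then show ?case
    by (intro exI[of _ "u + u'"] exI[of _ "v + v'"] exI[of _ "w + w'"]) (simp add: algebra_simps)
next
  case (mult x y)
  then obtain u v w u' v' w' :: int where x: "x = of_int u + of_int v * \<alpha> + of_int w * \<alpha>\<^sup>2"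
    and y: "y = of_int u' + of_int v' * \<alpha> + of_int w' * \<alpha>\<^sup>2" by blast
  have "x * y = of_int (u * u' + (v * w' + w * v') * N + w * w' * T * N)
      + of_int (u * v' + v * u' - (v * w' + w * v') * E + w * w' * (N - T * E)) * \<alpha>
      + of_int (u * w' + v * v' + w * u' + (v * w' + w * v') * T + w * w' * (T * T - E)) * \<alpha>\<^sup>2"
    unfolding x y quadratic_product_mod_cubic[OF assms(1)] by simp
  then show ?case by blast
qed

context pure_cubic
begin

text \<open>
  Modulo rational numbers, \<open>\<alpha>\<close> and \<open>\<alpha>\<^sup>2\<close> have coordinates with determinant
  \<open>b\<^sup>3 - p c\<^sup>3 = (B\<^sup>3 - p C\<^sup>3) / 27\<close> with respect to \<open>t, t\<^sup>2\<close>, while \<open>t\<close> and \<open>(1 + t + t\<^sup>2) / 3\<close>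
  have determinant \<open>1 / 3\<close>. The latter pair is an integral combination of the former (again
  modulo rational numbers), and \<open>k\<close> is the determinant of the transition matrix.
\<close>
lemma index_form_equation:
  assumes "[p = 1] (mod 3)" "t \<in> int_adjoin {\<alpha>}" "el (1/3) (1/3) (1/3) \<in> int_adjoin {\<alpha>}"
    "\<alpha> \<in> rat_adjoin {t}" "algebraic_int \<alpha>"
  shows "\<exists>B C k :: int. 3 dvd B - C \<and> k * (B ^ 3 - int p * C ^ 3) = 9"
proof -
  obtain a b c where \<alpha>: "\<alpha> = el a b c" using rat_adjoin_t assms(4) by blast
  have nz: "\<not> (b = 0 \<and> c = 0)" using assms(2) unfolding \<alpha> by (rule monogenic_generator_not_rational)
  have alg: "algebraic_int (el a b c)" using assms(5) by (simp add: \<alpha>)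
  obtain B C :: int where BC: "b = of_int B / 3" "c = of_int C / 3" "3 dvd B - C"
    using algebraic_int_coordinates[OF alg nz assms(1)] by blast
  obtain T E N :: int where TEN: "trace a = of_int T" "sigma2 a b c = of_int E" "norm_el a b c = of_int N"
    using characteristic_coefficients_integral[OF alg nz] by (auto elim!: Ints_cases)
  have "\<alpha> ^ 3 = of_int T * \<alpha>\<^sup>2 - of_int E * \<alpha> + of_int N"
    using characteristic_equation[of a b c] by (simp add: TEN \<alpha>)
  note span = int_adjoin_cubic[OF this]
  have coords: "of_int u + of_int v * \<alpha> + of_int w * \<alpha>\<^sup>2 =
      el (of_int u + of_int v * a + of_int w * (a * a + of_nat p * (b * c + c * b)))
        (of_int v * b + of_int w * (a * b + b * a + of_nat p * (c * c)))
        (of_int v * c + of_int w * (a * c + b * b + c * a))" for u v w :: int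
  proof -
    have "of_int u + of_int v * \<alpha> + of_int w * \<alpha>\<^sup>2
        = of_rat (of_int u) + of_rat (of_int v) * el a b c + of_rat (of_int w) * (el a b c * el a b c)"
      by (simp add: \<alpha> power2_eq_square)
    then show ?thesis by (simp only: el_mult el_scale el_add el_of_rat mult_zero_left mult_zero_right add_0_left add_0_right)
  qed
  have "t = el 0 1 0" by (simp add: el_def)
  then obtain u v w :: int where "el 0 1 0 = of_int u + of_int v * \<alpha> + of_int w * \<alpha>\<^sup>2"
    using span[OF assms(2)] by auto
  then have 1: "1 = of_int v * b + of_int w * (a * b + b * a + of_nat p * (c * c))"
       "0 = of_int v * c + of_int w * (a * c + b * b + c * a)"
    unfolding coords el_eq_iff by - (elim conjE, assumption)+
  obtain u' v' w' :: int
    where "el (1/3) (1/3) (1/3) = of_int u' + of_int v' * \<alpha> + of_int w' * \<alpha>\<^sup>2"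
    using span[OF assms(3)] by auto
  then have 2: "1/3 = of_int v' * b + of_int w' * (a * b + b * a + of_nat p * (c * c))"
       "1/3 = of_int v' * c + of_int w' * (a * c + b * b + c * a)"
    unfolding coords el_eq_iff by - (elim conjE, assumption)+
  have "of_int (v * w' - v' * w) * (b ^ 3 - of_nat p * c ^ 3)
      = (of_int v * b + of_int w * (a * b + b * a + of_nat p * (c * c)))
          * (of_int v' * c + of_int w' * (a * c + b * b + c * a))
        - (of_int v * c + of_int w * (a * c + b * b + c * a))
          * (of_int v' * b + of_int w' * (a * b + b * a + of_nat p * (c * c)))"
    by (simp add: algebra_simps power3_eq_cube)
  also have "\<dots> = 1 / 3" unfolding 1[symmetric] 2[symmetric] by simp
  finally have "of_int ((v * w' - v' * w) * (B ^ 3 - int p * C ^ 3)) = (of_int 9 :: rat)"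
    by (simp add: BC field_simps power3_eq_cube)
  then have "(v * w' - v' * w) * (B ^ 3 - int p * C ^ 3) = 9" by (simp only: of_int_eq_iff)
  with BC(3) show ?thesis by blast
qed

lemma algebraic_int_t: "algebraic_int t"
  unfolding algebraic_int_altdef_ipoly
  by (rule exI[of _ "[:- int p, 0, 0, 1:]"])
    (simp add: map_poly_pCons cube[symmetric] power3_eq_cube)

text \<open>
  With \<open>p = 9 k + 1\<close>, the number is a root of \<open>x\<^sup>3 - x\<^sup>2 - 3 k x - 3 k\<^sup>2\<close>.
\<close>
lemma algebraic_int_third:
  assumes "[p = 1] (mod 9)"
  shows "algebraic_int (el (1/3) (1/3) (1/3))"
proof -
  have "p \<ge> 1" using prime_gt_0_nat[OF prime_p] by simp
  then obtain k where k: "p = 9 * k + 1"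
    using assms by (metis cong_to_1_nat dvd_def le_add_diff_inverse2)
  have pk: "(of_nat p :: rat) = 9 * of_nat k + 1" by (simp add: k)
  have "trace (1/3) = 1" by (simp add: trace_def)
  moreover have "sigma2 (1/3) (1/3) (1/3) = of_int (- (3 * int k))"
    unfolding sigma2_def pk by (simp add: power2_eq_square algebra_simps)
  moreover have "norm_el (1/3) (1/3) (1/3) = of_int (3 * int k ^ 2)"
    unfolding norm_el_def pk by (simp add: power2_eq_square power3_eq_cube algebra_simps)
  ultimately have eq: "el (1/3) (1/3) (1/3) ^ 3 = (el (1/3) (1/3) (1/3))\<^sup>2
      - of_int (- (3 * int k)) * el (1/3) (1/3) (1/3) + of_int (3 * int k ^ 2)"
    using characteristic_equation[of "1/3" "1/3" "1/3"] by (simp only: of_rat_of_int_eq of_rat_1 mult_1_left)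
  show ?thesis
    unfolding algebraic_int_altdef_ipoly
    by (rule exI[of _ "[:- (3 * int k ^ 2), - (3 * int k), - 1, 1:]"])
      (use eq in \<open>simp add: map_poly_pCons algebra_simps power2_eq_square power3_eq_cube\<close>)
qed

lemma third_in_field: "el (1/3) (1/3) (1/3) \<in> rat_adjoin {t}"
proof -
  have "1 + 1 + 1 \<in> rat_adjoin {t}" by (intro rat_adjoin_intros(1,3))
  then have "inverse 3 \<in> rat_adjoin {t}" using rat_adjoin_intros(5)[of "3 :: real"] by simp
  moreover have "t \<in> rat_adjoin {t}" by (rule rat_adjoin_intros) simp
  ultimately have "inverse 3 * (1 + t + t * t) \<in> rat_adjoin {t}"
    by (intro rat_adjoin_intros(1,3,4))
  also have "inverse 3 * (1 + t + t * t) = el (1/3) (1/3) (1/3)"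
    by (simp add: el_def of_rat_divide power2_eq_square field_simps)
  finally show ?thesis .
qed

text \<open>
  From \<open>B \<equiv> C (mod 3)\<close> and \<open>p \<equiv> 1 (mod 9)\<close> one gets \<open>B\<^sup>3 \<equiv> C\<^sup>3 \<equiv> p C\<^sup>3 (mod 9)\<close>. So the
  value \<open>B\<^sup>3 - p C\<^sup>3\<close> of the index form, a divisor of \<open>9\<close>, must be \<open>\<plusminus> 9\<close>, and \<open>\<plusminus> B\<close> is a cube
  root of \<open>9\<close> modulo \<open>p\<close>.
\<close>
theorem nine_is_cube_if_monogenic:
  assumes "[p = 1] (mod 9)" "monogenic (rat_adjoin {t})"
  shows "\<exists>z :: int. [z ^ 3 = 9] (mod int p)"
proof -
  have p3: "[p = 1] (mod 3)" using assms(1) by (rule cong_dvd_modulus_nat) simp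
  obtain \<alpha> where \<alpha>: "\<alpha> \<in> ring_of_integers (rat_adjoin {t})"
      "ring_of_integers (rat_adjoin {t}) = int_adjoin {\<alpha>}"
    using assms(2) unfolding monogenic_def by blast
  have "t \<in> rat_adjoin {t}" by (rule rat_adjoin_intros) simp
  then have "t \<in> int_adjoin {\<alpha>}" "el (1/3) (1/3) (1/3) \<in> int_adjoin {\<alpha>}"
    using algebraic_int_t algebraic_int_third[OF assms(1)] third_in_field
    unfolding \<alpha>(2)[symmetric] ring_of_integers_def by blast+
  then obtain B C k :: int where BC: "3 dvd B - C" and k: "k * (B ^ 3 - int p * C ^ 3) = 9"
    using index_form_equation[OF p3] \<alpha>(1) unfolding ring_of_integers_def by blast
  have "[B ^ 3 - int p * C ^ 3 = 0] (mod 9)"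
  proof -
    obtain j where j: "B = C + 3 * j" using BC by (metis add.commute diff_add_cancel dvd_def)
    have "B ^ 3 - C ^ 3 = 9 * (j * C\<^sup>2 + 3 * j\<^sup>2 * C + 3 * j ^ 3)"
      by (simp add: j algebra_simps power2_eq_square power3_eq_cube)
    then have "9 dvd B ^ 3 - C ^ 3" by (metis dvd_triv_left)
    moreover have "9 dvd (int p - 1) * C ^ 3"
    proof -
      have "[int p = 1] (mod 9)" using assms(1) by (metis cong_int_iff of_nat_1 of_nat_numeral)
      then show ?thesis by (simp add: cong_iff_dvd_diff)
    qed
    ultimately have "9 dvd (B ^ 3 - C ^ 3) - (int p - 1) * C ^ 3" by (rule dvd_diff)
    then show ?thesis by (simp add: cong_iff_dvd_diff algebra_simps)
  qed
  then obtain l where l: "B ^ 3 - int p * C ^ 3 = 9 * l" by (auto simp: cong_0_iff)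
  then have "k * l = 1" using k by simp
  then have "l = 1 \<or> l = - 1" using zmult_eq_1_iff by blast
  then have "(l * B) ^ 3 - 9 = int p * (l * C ^ 3)" using l by (auto simp: algebra_simps)
  then have "[(l * B) ^ 3 = 9] (mod int p)" by (simp add: cong_iff_dvd_diff)
  then show ?thesis by blast
qed

end

text \<open>
  If \<open>9\<close> is a cube then so is \<open>3\<close>: both \<open>\<chi>(3)\<^sup>2 = \<chi>(9)\<close> and \<open>\<chi>(3)\<^sup>3\<close> are \<open>1\<close>.
\<close>
theorem represents_4p_if_9_cube:
  assumes "Factorial_Ring.prime p" "[p = 1] (mod 3)" "[z ^ 3 = (9::int)] (mod int p)"
  shows "\<exists>L M :: int. 4 * int p = L\<^sup>2 + 243 * M\<^sup>2"
proof -
  obtain \<chi> where "cubic_character p \<chi>" using cubic_character_exists[OF assms(1,2)] by blast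
  then interpret cubic_character p \<chi> .
  have "\<not> int p dvd 3"
  proof
    assume "int p dvd 3"
    then have "p dvd 3" by (metis int_dvd_int_iff of_nat_numeral)
    then have "p = 3" using assms(1) primes_dvd_imp_eq[of p 3] by simp
    then show False using assms(2) by (simp add: Cong.cong_def)
  qed
  moreover from this have n9: "\<not> int p dvd 9"
    using prime_p prime_dvd_multD[of "int p" 3 3] by auto
  ultimately have 3: "\<chi> 3 ^ 3 = 1" by (intro chi_power_3)
  have "\<not> int p dvd z ^ 3" using n9 assms(3) by (simp add: cong_dvd_iff)
  then have "\<not> int p dvd z" by (auto simp: power3_eq_cube)
  then have "\<chi> 9 = 1" using chi_cong[OF assms(3)] chi_cube_eq_1 by metis
  then have "\<chi> 3 ^ 2 = 1" using chi_mult[of 3 3] by (simp add: power2_eq_square)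
  then have "\<chi> 3 = 1" using 3 by (simp add: power2_eq_square power3_eq_cube)
  then show ?thesis by (rule represents_4p_if_3_cube)
qed

theorem theorem3:
  fixes p :: nat
  assumes "Factorial_Ring.prime p"
    and "[p = 1] (mod 9)"
    and "\<exists>x y :: int. int p = 7 * x\<^sup>2 + 3 * x * y + 9 * y\<^sup>2"
  shows "\<not> monogenic (rat_adjoin {root 3 (real p)})"
proof
  assume mono: "monogenic (rat_adjoin {root 3 (real p)})"
  interpret pure_cubic p "root 3 (real p)"
    by unfold_locales (use assms(1) in \<open>simp_all add: odd_real_root_pow\<close>)
  obtain z :: int where "[z ^ 3 = 9] (mod int p)" using nine_is_cube_if_monogenic[OF assms(2) mono] by blast
  moreover have "[p = 1] (mod 3)" using assms(2) by (rule cong_dvd_modulus_nat) simp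
  ultimately obtain L M :: int where "4 * int p = L\<^sup>2 + 243 * M\<^sup>2"
    using represents_4p_if_9_cube[OF assms(1)] by blast
  then show False using forms_disjoint[OF prime_int] assms(3) by blast
qed

end
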